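(* Let $m=(m_0,m_1,\ldots)$ be a bounded sequence of integers $m_k\ge 2$ and let $G_m$ be the associated bounded Vilenkin group. a) Let $0<p<1$ and let $\Phi:\mathbb{N}\rightarrow [1,\infty )$ be any non-decreasing function satisfying $\lim_{n\to\infty}\Phi(n)=+\infty$. Then there exists a martingale $f\in H_{p}^{\square }(G_{m}^{2})$ such that $$\sum_{n=1}^{\infty}\frac{\left\Vert S_{n,n}f\right\Vert_{weak-L_{p}}^{p}\,\Phi(n)}{n^{3-2p}}=\infty .$$ b) Let $\Phi:\mathbb{N}\rightarrow [1,\infty )$ be any non-decreasing function satisfying $\lim_{n\to\infty}\Phi(n)=+\infty$. Then there exists a martingale $f\in H_{1}^{\square }(G_{m}^{2})$ such that $$\sum_{n=1}^{\infty}\frac{\left\Vert S_{n,n}f\right\Vert_{1}\,\Phi(n)}{n\log^{2}(n+1)}=\infty .$$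
   Context: Setting. $m=(m_0,m_1,\ldots)$ is a sequence of integers $m_k\ge 2$ with $\sup_k m_k<\infty$; $Z_{m_k}=\{0,\ldots,m_k-1\}$ is the additive group of integers mod $m_k$ with the discrete topology; $G_m=\prod_{k\ge0}Z_{m_k}$ is the compact product group, with elements $x=(x_0,x_1,\ldots)$, and $\mu$ is its normalized Haar measure (product of the uniform measures). $I_0(x)=G_m$ and $I_n(x)=\{y\in G_m: y_0=x_0,\ldots,y_{n-1}=x_{n-1}\}$. $M_0=1$, $M_{k+1}=m_kM_k$; each $n\in\mathbb N=\{0,1,2,\ldots\}$ is uniquely $n=\sum_{j\ge0}n_jM_j$ with $n_j\in Z_{m_j}$. Vilenkin system: $r_k(x)=\exp(2\pi i x_k/m_k)$ and $\psi_n(x)=\prod_{k\ge0}r_k(x)^{n_k}$. Norms: $\|g\|_p=\left(\int_{G_m^2}|g|^p\,d(\mu\times\mu)\right)^{1/p}$ for $0<p<\infty$ (a quasi-norm if $p<1$), and $\|g\|_{weak-L_p}=\sup_{t>0}t\,\big((\mu\times\mu)(|g|>t)\big)^{1/p}$. Martingales and Hardy spaces: $\mathcal F_{n,n}$ is the $\sigma$-algebra on $G_m^2$ generated by the squares $I_n(x)\times I_n(y)$, $x,y\in G_m$. A martingale $f=(f_{n,n})_{n\in\mathbb N}$ is a martingale with respect to $(\mathcal F_{n,n})_{n\in\mathbb N}$; its maximal function is $f^*=\sup_{n}|f_{n,n}|$. $H_p^{\square}(G_m^2)$ is the set of such martingales with $\|f\|_{H_p^\square}:=\|f^*\|_p<\infty$.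 Fourier coefficients of a martingale: $\widehat f(i,j)=\lim_{k\to\infty}\int_{G_m^2}f_{k,k}(x,y)\overline{\psi_i(x)}\,\overline{\psi_j(y)}\,d\mu(x)\,d\mu(y)$. Rectangular partial sums: $S_{M,N}f(x,y)=\sum_{i=0}^{M-1}\sum_{j=0}^{N-1}\widehat f(i,j)\psi_i(x)\psi_j(y)$. *)

theory Defs
  imports "HOL-Probability.Probability"
begin

text \<open>The group \<open>G\<^sub>m\<close> is represented by the sequences \<open>x\<close> with \<open>x k \<in> {0..<m k}\<close>; these are the
  points of the space of the product measure below. The \<open>\<sigma>\<close>-algebra is the product of the power set
  algebras, i.e. the Borel \<open>\<sigma>\<close>-algebra of the product topology. The lemma
  \<open>vilenkin_measure_translation\<close> identifies the measure as the normalized Haar measure.\<close>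

definition vilenkin_measure :: "(nat \<Rightarrow> nat) \<Rightarrow> (nat \<Rightarrow> nat) measure" where
  "vilenkin_measure m = (\<Pi>\<^sub>M k\<in>UNIV. uniform_count_measure {0..<m k})"

definition vilenkin_group :: "(nat \<Rightarrow> nat) \<Rightarrow> (nat \<Rightarrow> nat) set" where
  "vilenkin_group m = {x. \<forall>k. x k < m k}"

definition vilenkin_add :: "(nat \<Rightarrow> nat) \<Rightarrow> (nat \<Rightarrow> nat) \<Rightarrow> (nat \<Rightarrow> nat) \<Rightarrow> (nat \<Rightarrow> nat)" where
  "vilenkin_add m x y = (\<lambda>k. (x k + y k) mod m k)"

definition vilenkin_measure2 ::
    "(nat \<Rightarrow> nat) \<Rightarrow> ((nat \<Rightarrow> nat) \<times> (nat \<Rightarrow> nat)) measure" where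
  "vilenkin_measure2 m = vilenkin_measure m \<Otimes>\<^sub>M vilenkin_measure m"

definition vilenkin_interval :: "(nat \<Rightarrow> nat) \<Rightarrow> nat \<Rightarrow> (nat \<Rightarrow> nat) \<Rightarrow> (nat \<Rightarrow> nat) set" where
  "vilenkin_interval m n x = {y \<in> vilenkin_group m. \<forall>k<n. y k = x k}"

primrec vilenkin_base :: "(nat \<Rightarrow> nat) \<Rightarrow> nat \<Rightarrow> nat" where
  "vilenkin_base m 0 = 1"
| "vilenkin_base m (Suc k) = m k * vilenkin_base m k"

text \<open>The \<open>j\<close>-th digit \<open>n\<^sub>j\<close> of \<open>n\<close> in the mixed-radix expansion \<open>n = (\<Sum>j. n\<^sub>j M\<^sub>j)\<close>; see the lemmas
  \<open>vilenkin_expansion\<close> and \<open>vilenkin_expansion_unique\<close>.\<close>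

definition vilenkin_digit :: "(nat \<Rightarrow> nat) \<Rightarrow> nat \<Rightarrow> nat \<Rightarrow> nat" where
  "vilenkin_digit m n j = (n div vilenkin_base m j) mod m j"

definition rademacher :: "(nat \<Rightarrow> nat) \<Rightarrow> nat \<Rightarrow> (nat \<Rightarrow> nat) \<Rightarrow> complex" where
  "rademacher m k x = exp (2 * of_real pi * \<i> * of_nat (x k) / of_nat (m k))"

definition vilenkin_fun :: "(nat \<Rightarrow> nat) \<Rightarrow> nat \<Rightarrow> (nat \<Rightarrow> nat) \<Rightarrow> complex" where
  "vilenkin_fun m n x = (\<Prod>k. rademacher m k x ^ vilenkin_digit m n k)"

text \<open>Norms take values in \<open>[0,\<infinity>]\<close>. The power \<open>x\<^sup>a\<close> is only meant for \<open>a > 0\<close>.\<close>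

definition ennreal_pow :: "ennreal \<Rightarrow> real \<Rightarrow> ennreal" where
  "ennreal_pow x a = (if x = \<infinity> then \<infinity> else ennreal (enn2real x powr a))"

text \<open>Both functionals take the absolute value \<open>h = \<bar>g\<bar>\<close> as an extended nonnegative function, so that
  they also apply to maximal functions, which may be infinite at some points.\<close>

definition Lp_norm :: "'a measure \<Rightarrow> real \<Rightarrow> ('a \<Rightarrow> ennreal) \<Rightarrow> ennreal" where
  "Lp_norm M p h = ennreal_pow (\<integral>\<^sup>+ z. ennreal_pow (h z) p \<partial>M) (1 / p)"

definition weak_Lp_norm :: "'a measure \<Rightarrow> real \<Rightarrow> ('a \<Rightarrow> ennreal) \<Rightarrow> ennreal" where
  "weak_Lp_norm M p h =
     (SUP t\<in>{0::real<..}. ennreal t * ennreal_pow (emeasure M {z \<in> space M. h z > ennreal t}) (1 / p))"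

definition square_algebra ::
    "(nat \<Rightarrow> nat) \<Rightarrow> nat \<Rightarrow> ((nat \<Rightarrow> nat) \<times> (nat \<Rightarrow> nat)) measure" where
  "square_algebra m n = sigma (vilenkin_group m \<times> vilenkin_group m)
     {vilenkin_interval m n x \<times> vilenkin_interval m n y | x y.
        x \<in> vilenkin_group m \<and> y \<in> vilenkin_group m}"

definition complex_cond_exp :: "'a measure \<Rightarrow> 'a measure \<Rightarrow> ('a \<Rightarrow> complex) \<Rightarrow> 'a \<Rightarrow> complex" where
  "complex_cond_exp M F g =
     (\<lambda>z. Complex (real_cond_exp M F (\<lambda>w. Re (g w)) z) (real_cond_exp M F (\<lambda>w. Im (g w)) z))"

definition martingale :: "'a measure \<Rightarrow> (nat \<Rightarrow> 'a measure) \<Rightarrow> (nat \<Rightarrow> 'a \<Rightarrow> complex) \<Rightarrow> bool" where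
  "martingale M F f \<longleftrightarrow>
     (\<forall>n. f n \<in> borel_measurable (F n)) \<and> (\<forall>n. integrable M (f n)) \<and>
     (\<forall>n k. n \<le> k \<longrightarrow> (AE z in M. complex_cond_exp M (F n) (f k) z = f n z))"

definition maximal_fun :: "(nat \<Rightarrow> 'a \<Rightarrow> complex) \<Rightarrow> 'a \<Rightarrow> ennreal" where
  "maximal_fun f z = (SUP n. ennreal (cmod (f n z)))"

definition hardy_space ::
    "(nat \<Rightarrow> nat) \<Rightarrow> real \<Rightarrow> (nat \<Rightarrow> (nat \<Rightarrow> nat) \<times> (nat \<Rightarrow> nat) \<Rightarrow> complex) set" where
  "hardy_space m p = {f. martingale (vilenkin_measure2 m) (square_algebra m) f \<and>
     Lp_norm (vilenkin_measure2 m) p (maximal_fun f) < \<infinity>}"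

definition fourier_coeff ::
    "(nat \<Rightarrow> nat) \<Rightarrow> (nat \<Rightarrow> (nat \<Rightarrow> nat) \<times> (nat \<Rightarrow> nat) \<Rightarrow> complex) \<Rightarrow> nat \<Rightarrow> nat \<Rightarrow> complex" where
  "fourier_coeff m f i j = lim (\<lambda>k. \<integral> z. f k z * cnj (vilenkin_fun m i (fst z))
       * cnj (vilenkin_fun m j (snd z)) \<partial>vilenkin_measure2 m)"

definition partial_sum ::
    "(nat \<Rightarrow> nat) \<Rightarrow> nat \<Rightarrow> nat \<Rightarrow> (nat \<Rightarrow> (nat \<Rightarrow> nat) \<times> (nat \<Rightarrow> nat) \<Rightarrow> complex) \<Rightarrow>
     (nat \<Rightarrow> nat) \<times> (nat \<Rightarrow> nat) \<Rightarrow> complex" where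
  "partial_sum m M N f z = (\<Sum>i<M. \<Sum>j<N. fourier_coeff m f i j
       * vilenkin_fun m i (fst z) * vilenkin_fun m j (snd z))"

lemma vilenkin_base_pos: "(\<And>k. m k \<ge> 2) \<Longrightarrow> vilenkin_base m k > 0"
proof (induction k)
  case (Suc k)
  have "m k > 0" using Suc.prems[of k] by linarith
  with Suc show ?case by simp
qed simp

lemma vilenkin_digit_less: "m j \<ge> 2 \<Longrightarrow> vilenkin_digit m n j < m j"
  by (simp add: vilenkin_digit_def)

lemma less_vilenkin_base: "(\<And>k. m k \<ge> 2) \<Longrightarrow> n < vilenkin_base m n"
proof (induction n)
  case (Suc n)
  then have "Suc n < 2 * vilenkin_base m n" by fastforce
  also have "\<dots> \<le> m n * vilenkin_base m n" using Suc.prems by (intro mult_right_mono) auto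
  finally show ?case by simp
qed simp

lemma vilenkin_expansion_mod:
  "n mod vilenkin_base m k = (\<Sum>j<k. vilenkin_digit m n j * vilenkin_base m j)"
proof (induction k)
  case (Suc k)
  have "n mod (vilenkin_base m k * m k) =
      vilenkin_base m k * (n div vilenkin_base m k mod m k) + n mod vilenkin_base m k"
    by (rule mod_mult2_eq)
  then show ?case using Suc by (simp add: vilenkin_digit_def mult.commute)
qed simp

lemma vilenkin_expansion:
  assumes "\<And>k. m k \<ge> 2" and "n \<le> k"
  shows "n = (\<Sum>j<k. vilenkin_digit m n j * vilenkin_base m j)"
proof -
  have "n < vilenkin_base m k"
    using less_vilenkin_base[of m k] assms by (meson le_less_trans)
  then show ?thesis using vilenkin_expansion_mod[of n m k] by simp
qed

lemma vilenkin_expansion_bound: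
  assumes "\<And>j. j < k \<Longrightarrow> d j < m j"
  shows "(\<Sum>j<k. d j * vilenkin_base m j) < vilenkin_base m k"
  using assms
proof (induction k)
  case (Suc k)
  have "(\<Sum>j<Suc k. d j * vilenkin_base m j) < (d k + 1) * vilenkin_base m k"
    using Suc by simp
  also have "\<dots> \<le> m k * vilenkin_base m k"
    using Suc.prems[of k] by (intro mult_right_mono) auto
  finally show ?case by simp
qed simp

lemma vilenkin_expansion_unique:
  assumes "\<And>j. d j < m j" and "j < k"
  shows "vilenkin_digit m (\<Sum>j<k. d j * vilenkin_base m j) j = d j"
  using \<open>j < k\<close>
proof (induction k)
  case (Suc k)
  let ?s = "\<Sum>j<k. d j * vilenkin_base m j"
  have s: "?s < vilenkin_base m k"
    using assms by (intro vilenkin_expansion_bound) auto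
  show ?case
  proof (cases "j = k")
    case True
    with s assms(1)[of k] show ?thesis by (simp add: vilenkin_digit_def)
  next
    case False
    with Suc.prems have jk: "Suc j \<le> k" by simp
    have "vilenkin_base m (Suc j) dvd vilenkin_base m k"
      using jk by (induction rule: dec_induct) auto
    then obtain c where "vilenkin_base m k = vilenkin_base m (Suc j) * c"
      by (rule dvdE)
    then have c: "vilenkin_base m k = vilenkin_base m j * (m j * c)"
      by (simp only: vilenkin_base.simps mult_ac)
    have "vilenkin_base m j \<noteq> 0" using c s by (metis less_zeroE mult_zero_left)
    moreover have "d k * vilenkin_base m k = vilenkin_base m j * (m j * (c * d k))"
      by (simp add: c mult_ac)
    ultimately have "(?s + d k * vilenkin_base m k) div vilenkin_base m j
        = m j * (c * d k) + ?s div vilenkin_base m j"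
      by (metis div_mult_self2)
    then have "vilenkin_digit m (?s + d k * vilenkin_base m k) j = vilenkin_digit m ?s j"
      by (simp add: vilenkin_digit_def)
    then show ?thesis using Suc jk by simp
  qed
qed simp

lemma vilenkin_fun_finite_prod:
  assumes "\<And>k. m k \<ge> 2" and "n \<le> K"
  shows "vilenkin_fun m n x = (\<Prod>k<K. rademacher m k x ^ vilenkin_digit m n k)"
  unfolding vilenkin_fun_def
proof (rule prodinf_finite)
  fix k assume "k \<notin> {..<K}"
  then have "n < vilenkin_base m k"
    using less_vilenkin_base[of m k] assms by (meson le_less_trans le_trans lessThan_iff not_le)
  then show "rademacher m k x ^ vilenkin_digit m n k = 1" by (simp add: vilenkin_digit_def)
qed simp

lemma space_vilenkin_measure: "space (vilenkin_measure m) = vilenkin_group m"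
  by (auto simp: vilenkin_measure_def vilenkin_group_def space_PiM space_uniform_count_measure)

lemma space_vilenkin_measure2:
  "space (vilenkin_measure2 m) = vilenkin_group m \<times> vilenkin_group m"
  by (simp add: vilenkin_measure2_def space_pair_measure space_vilenkin_measure)

lemma product_prob_space_vilenkin:
  fixes m :: "'i \<Rightarrow> nat"
  assumes "\<And>k. m k \<ge> 2"
  shows "product_prob_space (\<lambda>k. uniform_count_measure {0..<m k})"
proof -
  have *: "prob_space (uniform_count_measure {0..<m k})" for k
    using assms[of k] by (intro prob_space_uniform_count_measure) auto
  interpret prob_space "uniform_count_measure {0..<m k}" for k by (rule *)
  show ?thesis by unfold_locales
qed

lemma prob_space_vilenkin_measure:
  assumes "\<And>k. m k \<ge> 2"
  shows "prob_space (vilenkin_measure m)"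
  unfolding vilenkin_measure_def
proof (intro prob_space_PiM prob_space_uniform_count_measure)
  show "{0..<m k} \<noteq> {}" for k using assms[of k] by auto
qed auto

lemma prob_space_vilenkin_measure2:
  assumes "\<And>k. m k \<ge> 2"
  shows "prob_space (vilenkin_measure2 m)"
  unfolding vilenkin_measure2_def by (intro prob_space_pair prob_space_vilenkin_measure assms)

lemma vilenkin_interval_sets [measurable]: "vilenkin_interval m n x \<in> sets (vilenkin_measure m)"
proof -
  have "Measurable.pred (vilenkin_measure m) (\<lambda>y. y k = x k)" for k
  proof -
    have "(\<lambda>y. y k) \<in> vilenkin_measure m \<rightarrow>\<^sub>M uniform_count_measure {0..<m k}"
      unfolding vilenkin_measure_def by (rule measurable_component_singleton) simp
    moreover have "Measurable.pred (uniform_count_measure {0..<m k}) (\<lambda>i. i = x k)"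
      by (auto simp: pred_def sets_uniform_count_measure space_uniform_count_measure)
    ultimately show ?thesis by (rule measurable_compose)
  qed
  then have "Measurable.pred (vilenkin_measure m) (\<lambda>y. \<forall>k\<in>{..<n}. y k = x k)"
    by (intro pred_intros_finite(3)) (rule finite_lessThan)
  then have "{y \<in> vilenkin_group m. \<forall>k\<in>{..<n}. y k = x k} \<in> sets (vilenkin_measure m)"
    unfolding pred_def space_vilenkin_measure .
  moreover have "vilenkin_interval m n x = {y \<in> vilenkin_group m. \<forall>k\<in>{..<n}. y k = x k}"
    unfolding vilenkin_interval_def by auto
  ultimately show ?thesis by metis
qed

lemma vilenkin_measure_translation:
  assumes m: "\<And>k. m k \<ge> 2" and a: "a \<in> vilenkin_group m"
  shows "distr (vilenkin_measure m) (vilenkin_measure m) (vilenkin_add m a) = vilenkin_measure m"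
proof -
  define U where "U = (\<lambda>k. uniform_count_measure {0..<m k})"
  interpret product_prob_space U UNIV
    unfolding U_def by (rule product_prob_space_vilenkin[OF m])
  have V: "vilenkin_measure m = PiM UNIV U" unfolding vilenkin_measure_def U_def ..
  have setsU: "sets (U k) = Pow {0..<m k}" and spU: "space (U k) = {0..<m k}" for k
    by (auto simp: U_def sets_uniform_count_measure space_uniform_count_measure)
  have m0: "m k > 0" for k using m[of k] by linarith
  let ?t = "\<lambda>k i. (a k + i) mod m k"
  have tk: "?t k \<in> U k \<rightarrow>\<^sub>M U k" for k
    using m0[of k] by (auto simp: measurable_def setsU spU)
  have meas: "vilenkin_add m a \<in> PiM UNIV U \<rightarrow>\<^sub>M PiM UNIV U"
    unfolding vilenkin_add_def
  proof (rule measurable_PiM_single')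
    show "(\<lambda>x. ?t k (x k)) \<in> PiM UNIV U \<rightarrow>\<^sub>M U k" for k
      by (rule measurable_compose[OF measurable_component_singleton[of k UNIV U] tk[of k]]) simp
    show "(\<lambda>x k. ?t k (x k)) \<in> space (PiM UNIV U) \<rightarrow> (\<Pi>\<^sub>E k\<in>UNIV. space (U k))"
      by (auto simp: spU m0)
  qed
  have inj: "inj_on (?t k) {0..<m k}" for k
  proof (rule inj_onI)
    fix i j assume ij: "i \<in> {0..<m k}" "j \<in> {0..<m k}" and eq: "?t k i = ?t k j"
    have "int (m k) dvd int i - int j"
      using arg_cong[OF eq, of int] by (simp add: of_nat_mod mod_eq_dvd_iff)
    moreover have "\<bar>int i - int j\<bar> < int (m k)" using ij by auto
    ultimately show "i = j" using dvd_imp_le_int[of "int i - int j" "int (m k)"] by auto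
  qed
  have bij: "bij_betw (?t k) {0..<m k} {0..<m k}" for k
  proof -
    have "?t k ` {0..<m k} \<subseteq> {0..<m k}" using m0[of k] by auto
    then show ?thesis using inj[of k]
      by (simp add: bij_betw_def endo_inj_surj)
  qed
  have em: "emeasure (U k) (?t k -` A \<inter> {0..<m k}) = emeasure (U k) A" if "A \<subseteq> {0..<m k}" for k A
  proof -
    have "?t k ` (?t k -` A \<inter> {0..<m k}) = A"
      using bij[of k] that by (fastforce simp: bij_betw_def)
    moreover have "inj_on (?t k) (?t k -` A \<inter> {0..<m k})"
      using inj[of k] by (rule inj_on_subset) auto
    ultimately have "card (?t k -` A \<inter> {0..<m k}) = card A" by (metis card_image)
    then show ?thesis
      using that by (simp add: U_def emeasure_uniform_count_measure)
  qed
  have "distr (PiM UNIV U) (PiM UNIV U) (vilenkin_add m a) = PiM UNIV U"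
  proof (rule PiM_eq)
    show "sets (distr (PiM UNIV U) (PiM UNIV U) (vilenkin_add m a)) = sets (PiM UNIV U)" by simp
  next
    fix J :: "nat set" and A
    assume J: "finite J" "J \<subseteq> UNIV" and A: "\<And>i. i \<in> J \<Longrightarrow> A i \<in> sets (U i)"
    have A': "A i \<subseteq> {0..<m i}" if "i \<in> J" for i using A[OF that] by (auto simp: setsU)
    have pre: "vilenkin_add m a -` prod_emb UNIV U J (Pi\<^sub>E J A) \<inter> space (PiM UNIV U)
        = prod_emb UNIV U J (\<Pi>\<^sub>E k\<in>J. ?t k -` A k \<inter> {0..<m k})"
      using m0 by (auto simp: prod_emb_def space_PiM spU vilenkin_add_def PiE_iff extensional_def restrict_def)
    have "emeasure (distr (PiM UNIV U) (PiM UNIV U) (vilenkin_add m a)) (prod_emb UNIV U J (Pi\<^sub>E J A))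
        = emeasure (PiM UNIV U) (prod_emb UNIV U J (\<Pi>\<^sub>E k\<in>J. ?t k -` A k \<inter> {0..<m k}))"
      using J A meas by (subst emeasure_distr) (auto simp: pre intro!: sets_PiM_I)
    also have "\<dots> = (\<Prod>k\<in>J. emeasure (U k) (?t k -` A k \<inter> {0..<m k}))"
      using J by (intro emeasure_PiM_emb) (auto simp: setsU)
    also have "\<dots> = (\<Prod>k\<in>J. emeasure (U k) (A k))"
      using A' by (intro prod.cong refl em)
    finally show "emeasure (distr (PiM UNIV U) (PiM UNIV U) (vilenkin_add m a))
        (prod_emb UNIV U J (Pi\<^sub>E J A)) = (\<Prod>k\<in>J. emeasure (U k) (A k))" .
  qed
  then show ?thesis by (simp add: V)
qed

lemma subalgebra_square_algebra: "subalgebra (vilenkin_measure2 m) (square_algebra m n)"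
  unfolding subalgebra_def
proof
  have sub: "{vilenkin_interval m n x \<times> vilenkin_interval m n y | x y.
      x \<in> vilenkin_group m \<and> y \<in> vilenkin_group m} \<subseteq> Pow (vilenkin_group m \<times> vilenkin_group m)"
    by (auto simp: vilenkin_interval_def)
  show "space (square_algebra m n) = space (vilenkin_measure2 m)"
    using sub by (simp add: square_algebra_def space_measure_of space_vilenkin_measure2)
  show "sets (square_algebra m n) \<subseteq> sets (vilenkin_measure2 m)"
    unfolding square_algebra_def sets_measure_of[OF sub]
    unfolding space_vilenkin_measure2[symmetric]
    unfolding vilenkin_measure2_def
    by (rule sets.sigma_sets_subset) (auto intro!: pair_measureI vilenkin_interval_sets)
qed

lemma finite_vilenkin_intervals: "finite (vilenkin_interval m n ` vilenkin_group m)"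
proof -
  have "vilenkin_interval m n ` vilenkin_group m \<subseteq> vilenkin_interval m n ` (\<Pi>\<^sub>E k\<in>{..<n}. {..<m k})"
  proof
    fix I assume "I \<in> vilenkin_interval m n ` vilenkin_group m"
    then obtain x where x: "x \<in> vilenkin_group m" "I = vilenkin_interval m n x" by auto
    have "I = vilenkin_interval m n (restrict x {..<n})"
      by (auto simp: x vilenkin_interval_def)
    moreover have "restrict x {..<n} \<in> (\<Pi>\<^sub>E k\<in>{..<n}. {..<m k})"
      using x by (auto simp: vilenkin_group_def)
    ultimately show "I \<in> vilenkin_interval m n ` (\<Pi>\<^sub>E k\<in>{..<n}. {..<m k})" by blast
  qed
  then show ?thesis by (rule finite_subset) (intro finite_imageI finite_PiE, auto)
qed

lemma filtration_square_algebra: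
  "filtration (vilenkin_group m \<times> vilenkin_group m) (square_algebra m)"
proof
  fix n show "space (square_algebra m n) = vilenkin_group m \<times> vilenkin_group m"
    using subalgebra_square_algebra[of m n] by (simp add: subalgebra_def space_vilenkin_measure2)
next
  fix n N :: nat assume nN: "n \<le> N"
  let ?G = "vilenkin_group m" and ?I = "vilenkin_interval m"
  let ?S = "\<lambda>n. {?I n x \<times> ?I n y | x y. x \<in> ?G \<and> y \<in> ?G}"
  have sub: "?S n \<subseteq> Pow (?G \<times> ?G)" for n by (auto simp: vilenkin_interval_def)
  have sp: "space (square_algebra m N) = ?G \<times> ?G"
    using subalgebra_square_algebra[of m N] by (simp add: subalgebra_def space_vilenkin_measure2)
  have fin: "finite (?S N)"
  proof (rule finite_subset)
    show "?S N \<subseteq> (\<lambda>(A, B). A \<times> B) ` ((?I N ` ?G) \<times> (?I N ` ?G))" by auto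
    show "finite ((\<lambda>(A, B). A \<times> B) ` ((?I N ` ?G) \<times> (?I N ` ?G)))"
      by (intro finite_imageI finite_cartesian_product finite_vilenkin_intervals)
  qed
  have "?S n \<subseteq> sets (square_algebra m N)"
  proof
    fix Q assume "Q \<in> ?S n"
    then obtain x y where Q: "Q = ?I n x \<times> ?I n y" by auto
    define C where "C = {R \<in> ?S N. R \<subseteq> Q}"
    have "Q \<subseteq> \<Union>C"
    proof
      fix z assume z: "z \<in> Q"
      let ?R = "?I N (fst z) \<times> ?I N (snd z)"
      have "fst z \<in> ?G" "snd z \<in> ?G" using z by (auto simp: Q vilenkin_interval_def)
      then have "?R \<in> ?S N" "z \<in> ?R" by (auto simp: vilenkin_interval_def mem_Times_iff)
      moreover have "?R \<subseteq> Q" using z nN by (auto simp: Q vilenkin_interval_def)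
      ultimately show "z \<in> \<Union>C" by (auto simp: C_def)
    qed
    then have "Q = \<Union>C" by (auto simp: C_def)
    moreover have "finite C" using fin by (simp add: C_def)
    moreover have "C \<subseteq> sets (square_algebra m N)"
      by (auto simp: C_def square_algebra_def sets_measure_of[OF sub])
    ultimately show "Q \<in> sets (square_algebra m N)" by (metis sets.finite_Union)
  qed
  then have "sigma_sets (space (square_algebra m N)) (?S n) \<subseteq> sets (square_algebra m N)"
    by (rule sets.sigma_sets_subset)
  then show "sets (square_algebra m n) \<subseteq> sets (square_algebra m N)"
    unfolding sp by (simp add: square_algebra_def sets_measure_of[OF sub])
qed

end

theory Submission
  imports Defs "HOL-Real_Asymp.Real_Asymp"
begin

text \<open>
  Both parts use lacunary martingales \<open>f = (\<Sum>k. c\<^sub>k b\<^sub>a)\<close>, \<open>a = \<alpha> k\<close>, built from the square blocks of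
  characters \<open>b\<^sub>a(x, y) = (\<Sum>i. \<psi>\<^sub>i x) (\<Sum>j. \<psi>\<^sub>j y)\<close> with \<open>M\<^sub>a \<le> i, j < 2 M\<^sub>a\<close>. Since
  \<open>\<Sum>i. \<psi>\<^sub>i = \<psi>\<^sub>M D\<^sub>M\<close> for \<open>M = M\<^sub>a\<close>, such a block has modulus \<open>M\<^sub>a\<^sup>2\<close> on the square \<open>I\<^sub>a(0) \<times> I\<^sub>a(0)\<close> and
  vanishes elsewhere; it has mean zero on every set of \<open>F\<^sub>a\<close> and is measurable for \<open>F\<^sub>n\<close>, \<open>n > a\<close>. So the
  sums over \<open>\<alpha> k < n\<close> are a martingale whose maximal function is at most \<open>\<Sum>k. c\<^sub>k \<bar>b\<^sub>a\<bar>\<close>, and the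
  subadditivity of \<open>t \<mapsto> t\<^sup>p\<close>, \<open>p \<le> 1\<close>, puts it into the Hardy space as soon as
  \<open>\<Sum>k. (c\<^sub>k M\<^sub>a\<^sup>2)\<^sup>p / M\<^sub>a\<^sup>2\<close> converges (\<open>lacunary_in_hardy_space\<close>). The coefficients are chosen such that
  this is the series of the \<open>2\<^sup>-\<^sup>k\<close>.

  Although the blocks are concentrated on small squares, cutting one of them at \<open>n = M\<^sub>a + l\<close>, \<open>l < M\<^sub>a\<close>,
  spreads it out: up to factors of modulus one, the last block of \<open>S\<^sub>n\<^sub>,\<^sub>n f\<close> is
  \<open>c\<^sub>k D\<^sub>l(x) D\<^sub>l(y)\<close>, and \<open>D\<^sub>l\<close> is not small away from \<open>0\<close>. All that is needed about it is
  \<open>norm_dirichlet_kernel\<close>: if \<open>x\<close> has exactly \<open>j\<close> leading zeros and \<open>r = l mod M\<^sub>j\<^sub>+\<^sub>1\<close> is at most \<open>M\<^sub>j\<close>,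
  then \<open>\<bar>D\<^sub>l(x)\<bar> = r\<close>, because complete groups of \<open>M\<^sub>j\<^sub>+\<^sub>1\<close> consecutive characters cancel at \<open>x\<close> and the
  last \<open>r\<close> characters agree there.

  For \<open>p < 1\<close> the case \<open>j = 0\<close> suffices: if \<open>l\<close> is \<open>1\<close> modulo \<open>m\<^sub>0\<close>, then \<open>\<bar>D\<^sub>l\<bar> = 1\<close> off \<open>I\<^sub>1(0)\<close>, a set of
  measure at least \<open>1/2\<close>, so the weak norm of the last block is at least a constant times \<open>c\<^sub>k\<close>. For
  \<open>p = 1\<close>, averaging over \<open>l < M\<^sub>a\<close> makes every \<open>j < a\<close> contribute at least \<open>1 / (4 sup m)\<close> to the mean of
  the Lebesgue constants (\<open>sum_lebesgue_constant_ge\<close>), and by the Cauchy-Schwarz inequality the mean of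
  their squares, which are the norms of the \<open>D\<^sub>l(x) D\<^sub>l(y)\<close>, grows at least like \<open>a\<^sup>2\<close>, that is, like the
  \<open>log\<^sup>2 n\<close> in the denominator.

  In both cases the indices \<open>n\<close> with \<open>M\<^sub>a \<le> n < 2 M\<^sub>a\<close> together contribute at least a constant times
  \<open>2\<^sup>-\<^sup>k \<Phi>(M\<^sub>a)\<close>, provided that the earlier blocks, which are bounded by a number fixed before \<open>\<alpha> k\<close> is
  chosen, are negligible. Choosing \<open>\<alpha> k\<close> large enough one after the other, with \<open>\<Phi>(M\<^sub>a) \<ge> 4\<^sup>k\<close>, makes
  these contributions unbounded.
\<close>

section \<open>Powers, sums and greedy sequences\<close>

lemma inj_on_cis_root_unity:
  assumes "n > 0"
  shows "inj_on (\<lambda>k. cis (2 * pi * real k / real n)) {..<n}"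
  using Complex.bij_betw_roots_unity[OF assms] by (simp add: bij_betw_def)

lemma sum_lessThan_add:
  fixes g :: "nat \<Rightarrow> 'a :: comm_monoid_add"
  shows "(\<Sum>i<a + b. g i) = (\<Sum>i<a. g i) + (\<Sum>i<b. g (a + i))"
  by (induction b) (simp_all add: add.assoc)

lemma sum_mod_period:
  fixes g :: "nat \<Rightarrow> real"
  shows "(\<Sum>l<q * P. g (l mod P)) = real q * (\<Sum>r<P. g r)"
proof (induction q)
  case (Suc q)
  have "(\<Sum>l<q * P + P. g (l mod P)) = (\<Sum>l<q * P. g (l mod P)) + (\<Sum>r<P. g r)"
    unfolding sum_lessThan_add by simp
  then show ?case using Suc by (simp add: algebra_simps)
qed simp

lemma ennreal_pow_ennreal: "x \<ge> 0 \<Longrightarrow> ennreal_pow (ennreal x) a = ennreal (x powr a)"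
  by (simp add: ennreal_pow_def)

lemma ennreal_pow_one [simp]: "ennreal_pow x 1 = x"
  by (cases x) (auto simp: ennreal_pow_def)

lemma ennreal_pow_mono:
  assumes "x \<le> y" "a \<ge> 0"
  shows "ennreal_pow x a \<le> ennreal_pow y a"
proof (cases y)
  case (real r)
  then obtain s where "x = ennreal s" "0 \<le> s" using assms(1) by (cases x) (auto simp: top_unique)
  then show ?thesis using real assms by (auto simp: ennreal_pow_ennreal intro!: ennreal_leI powr_mono2)
qed (simp add: ennreal_pow_def)

text \<open>For \<open>u \<le> s = x + y\<close> the ratio \<open>u / s\<close> lies in \<open>[0, 1]\<close>, where raising to the power \<open>p \<le> 1\<close> increases
  it; adding this for \<open>u = x\<close> and \<open>u = y\<close> gives the claim.\<close>
lemma powr_add_le: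
  fixes x y p :: real
  assumes "0 \<le> x" "0 \<le> y" "0 < p" "p \<le> 1"
  shows "(x + y) powr p \<le> x powr p + y powr p"
proof (cases "x + y = 0")
  case False
  define s where "s = x + y"
  have s: "s > 0" using False assms by (simp add: s_def)
  have le: "u / s \<le> u powr p / s powr p" if "0 \<le> u" "u \<le> s" for u
    using powr_mono'[of p 1 "u / s"] that s assms by (simp add: powr_divide)
  have "1 = x / s + y / s" using s by (simp add: s_def add_divide_distrib[symmetric])
  also have "\<dots> \<le> x powr p / s powr p + y powr p / s powr p"
    using assms by (intro add_mono le) (auto simp: s_def)
  finally have "s powr p \<le> x powr p + y powr p"
    using s by (simp add: add_divide_distrib[symmetric] le_divide_eq)
  then show ?thesis by (simp add: s_def)
qed (use assms in auto)

lemma powr_sum_le: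
  fixes f :: "'a \<Rightarrow> real"
  assumes "finite A" "\<And>i. i \<in> A \<Longrightarrow> 0 \<le> f i" "0 < p" "p \<le> 1"
  shows "(\<Sum>i\<in>A. f i) powr p \<le> (\<Sum>i\<in>A. f i powr p)"
  using assms
proof (induction A rule: finite_induct)
  case (insert a A)
  have "(f a + (\<Sum>i\<in>A. f i)) powr p \<le> f a powr p + (\<Sum>i\<in>A. f i) powr p"
    using insert by (intro powr_add_le sum_nonneg) auto
  then show ?case using insert by fastforce
qed simp

text \<open>The weak norm is tested at the single level \<open>t\<close>.\<close>
lemma weak_Lp_norm_powr_ge:
  assumes p: "0 < p" and t: "0 < t" and q: "0 \<le> q"
    and g: "g \<in> borel_measurable N"
    and S: "S \<in> sets N" "ennreal q \<le> emeasure N S" "\<And>z. z \<in> S \<Longrightarrow> t < g z"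
  shows "ennreal (t powr p * q) \<le> ennreal_pow (weak_Lp_norm N p (\<lambda>z. ennreal (g z))) p"
proof -
  let ?E = "{z \<in> space N. ennreal (g z) > ennreal t}"
  have "?E \<in> sets N" using g by measurable
  moreover have "S \<subseteq> ?E"
    using S(1,3) t sets.sets_into_space by (fastforce simp: ennreal_less_iff)
  ultimately have "ennreal q \<le> emeasure N ?E"
    using S(2) by (meson emeasure_mono order_trans)
  then have "ennreal t * ennreal_pow (ennreal q) (1 / p) \<le> ennreal t * ennreal_pow (emeasure N ?E) (1 / p)"
    using p by (intro mult_left_mono ennreal_pow_mono) auto
  also have "\<dots> \<le> weak_Lp_norm N p (\<lambda>z. ennreal (g z))"
    unfolding weak_Lp_norm_def using t by (intro SUP_upper) simp
  finally have "ennreal (t * q powr (1 / p)) \<le> weak_Lp_norm N p (\<lambda>z. ennreal (g z))"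
    using t q by (simp add: ennreal_pow_ennreal ennreal_mult)
  then have "ennreal_pow (ennreal (t * q powr (1 / p))) p
      \<le> ennreal_pow (weak_Lp_norm N p (\<lambda>z. ennreal (g z))) p"
    using p by (intro ennreal_pow_mono) auto
  moreover have "(t * q powr (1 / p)) powr p = t powr p * q"
    using p t q by (simp add: powr_mult powr_powr)
  ultimately show ?thesis using t by (simp add: ennreal_pow_ennreal)
qed

lemma ennreal_sum_le: "ennreal (\<Sum>i\<in>A. f i) \<le> (\<Sum>i\<in>A. ennreal (f i))"
proof -
  have "ennreal (\<Sum>i\<in>A. f i) \<le> ennreal (\<Sum>i\<in>A. max 0 (f i))"
    by (intro ennreal_leI sum_mono) simp
  also have "\<dots> = (\<Sum>i\<in>A. ennreal (max 0 (f i)))" by (rule sum_ennreal[symmetric]) simp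
  also have "\<dots> = (\<Sum>i\<in>A. ennreal (f i))"
    by (intro sum.cong refl) (auto simp: max_def ennreal_neg)
  finally show ?thesis .
qed

text \<open>The partial sum over the index set \<open>a k + L k\<close> is a lower bound for the series for every single \<open>k\<close>,
  and these bounds grow without limit.\<close>
lemma suminf_eq_top_of_blocks:
  fixes F :: "nat \<Rightarrow> ennreal"
  assumes a: "\<And>k. a k \<ge> (1::nat)" and L: "\<And>k. finite (L k)" and d: "d > 0"
    and ge: "\<And>k. ennreal (2 ^ k * d) \<le> (\<Sum>l\<in>L k. F (a k + l))"
  shows "(\<Sum>k. F (Suc k)) = \<infinity>"
proof (rule ccontr)
  assume "(\<Sum>k. F (Suc k)) \<noteq> \<infinity>"
  then obtain s where s: "(\<Sum>k. F (Suc k)) = ennreal s" "0 \<le> s" by (cases "\<Sum>k. F (Suc k)") auto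
  obtain k where k: "s / d < 2 ^ k" using real_arch_pow[of 2 "s / d"] by auto
  have "(\<Sum>l\<in>L k. F (a k + l)) = (\<Sum>l\<in>L k. F (Suc (a k + l - 1)))"
    using a[of k] by (intro sum.cong refl) simp
  also have "\<dots> = (\<Sum>i\<in>(\<lambda>l. a k + l - 1) ` L k. F (Suc i))"
    using a[of k] by (subst sum.reindex) (auto simp: inj_on_def)
  also have "\<dots> \<le> (\<Sum>k. F (Suc k))"
    using L[of k] by (intro sum_le_suminf summableI) auto
  finally have "(\<Sum>l\<in>L k. F (a k + l)) \<le> ennreal s" unfolding s(1) .
  with ge[of k] have "ennreal (2 ^ k * d) \<le> ennreal s" by (rule order_trans)
  then have "2 ^ k * d \<le> s" using s by simp
  then show False using k d by (simp add: field_simps)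
qed

text \<open>Each \<open>\<alpha> k\<close> is chosen with knowledge of a bound accumulated from the previous choices; \<open>w j a\<close> is the
  contribution of choosing \<open>\<alpha> j = a\<close>. The recursion carries the pair of the last choice and the
  accumulated sum.\<close>
lemma greedy_strict_mono_sequence:
  fixes Q :: "nat \<Rightarrow> real \<Rightarrow> nat \<Rightarrow> bool" and w :: "nat \<Rightarrow> nat \<Rightarrow> real"
  assumes Q: "\<And>k C. eventually (Q k C) sequentially"
  obtains \<alpha> where "strict_mono \<alpha>" "\<And>k. Q k (\<Sum>j<k. w j (\<alpha> j)) (\<alpha> k)"
proof -
  define P where "P = (\<lambda>n (s :: nat \<times> real). Q n (snd s) (fst s) \<and> (n = 0 \<longrightarrow> snd s = 0))"
  define R where "R = (\<lambda>n (s :: nat \<times> real) s'. fst s < fst s' \<and> snd s' = snd s + w n (fst s))"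
  have ex: "\<exists>a>b. Q k C a" for k C b
    using eventually_conj[OF Q[of k C] eventually_gt_at_top[of b]] by (auto simp: eventually_sequentially)
  have "\<exists>s. P 0 s" using ex[of _ 0 0] by (auto simp: P_def)
  moreover have "\<exists>s'. P (Suc n) s' \<and> R n s s'" for n s
    using ex[of "fst s" "Suc n" "snd s + w n (fst s)"] by (auto simp: P_def R_def)
  ultimately obtain s where s: "\<And>n. P n (s n)" "\<And>n. R n (s n) (s (Suc n))"
    using dependent_nat_choice[of P R] by blast
  have C: "snd (s k) = (\<Sum>j<k. w j (fst (s j)))" for k
    using s by (induction k) (auto simp: P_def R_def)
  show thesis
  proof
    show "strict_mono (\<lambda>k. fst (s k))" using s(2) by (simp add: strict_mono_Suc_iff R_def)
    show "Q k (\<Sum>j<k. w j (fst (s j))) (fst (s k))" for k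
      using s(1)[of k] by (simp add: P_def C)
  qed
qed

section \<open>Digits and characters\<close>

locale vilenkin =
  fixes m :: "nat \<Rightarrow> nat"
  assumes m_ge: "\<And>k. m k \<ge> 2"
begin

abbreviation "M \<equiv> vilenkin_base m"
abbreviation "G \<equiv> vilenkin_group m"
abbreviation "digit \<equiv> vilenkin_digit m"
abbreviation "\<psi> \<equiv> vilenkin_fun m"
abbreviation "add \<equiv> vilenkin_add m"
abbreviation "\<mu> \<equiv> vilenkin_measure m"
abbreviation "\<mu>2 \<equiv> vilenkin_measure2 m"

lemma M_pos [simp]: "M k > 0"
  using m_ge by (rule vilenkin_base_pos)

lemma m_pos [simp]: "m k > 0"
  using m_ge[of k] by simp

lemma M_dvd: "j \<le> k \<Longrightarrow> M j dvd M k"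
  by (induction rule: dec_induct) auto

lemma M_mono: "j \<le> k \<Longrightarrow> M j \<le> M k"
  by (rule dvd_imp_le[OF M_dvd]) auto

lemma double_M_le:
  assumes "j < k"
  shows "2 * M j \<le> M k"
proof -
  have "2 * M j \<le> M (Suc j)" using m_ge[of j] by simp
  also have "\<dots> \<le> M k" using assms by (intro M_mono) simp
  finally show ?thesis .
qed

lemma less_M: "n < M n"
  using m_ge by (rule less_vilenkin_base)

lemma digit_small: "i < M j \<Longrightarrow> j \<le> t \<Longrightarrow> digit i t = 0"
  using M_mono[of j t] by (simp add: vilenkin_digit_def)

text \<open>The numbers \<open>u * M J\<close> and \<open>i\<close> occupy disjoint ranges of digit positions, so there are no carries.\<close>
lemma digit_block_add:
  assumes i: "i < M J"
  shows "digit (u * M J + i) t = digit (u * M J) t + digit i t"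
proof (cases "t < J")
  case True
  then obtain c where "M J = M (Suc t) * c" using M_dvd[of "Suc t" J] by (auto elim: dvdE)
  then have c: "u * M J = M t * (m t * (u * c))" by (simp add: mult_ac)
  have "digit (u * M J) t = 0" unfolding c vilenkin_digit_def by simp
  moreover have "digit (u * M J + i) t = digit i t"
    unfolding c vilenkin_digit_def by simp
  ultimately show ?thesis by simp
next
  case False
  then obtain c where c: "M t = M J * c" using M_dvd[of J t] by (auto elim: dvdE)
  have "(u * M J + i) div M t = u * M J div M t"
    using i unfolding c by (simp add: div_mult2_eq)
  moreover have "digit i t = 0" using i False by (intro digit_small) auto
  ultimately show ?thesis by (simp add: vilenkin_digit_def)
qed

lemma digit_eqI:
  assumes "\<And>t. digit i t = digit j t"
  shows "i = j"
proof -
  have "i = (\<Sum>t<max i j. digit i t * M t)" "j = (\<Sum>t<max i j. digit j t * M t)"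
    using m_ge by (auto intro!: vilenkin_expansion)
  then show ?thesis using assms by simp
qed

lemma digit_block:
  assumes "i \<in> {M a..<2 * M a}"
  shows "digit i a = 1"
proof -
  have "i div M a = 1" using assms by (intro div_nat_eqI) auto
  then show ?thesis using m_ge[of a] by (simp add: vilenkin_digit_def)
qed

lemma rademacher_eq_cis: "rademacher m k x = cis (2 * pi * real (x k) / real (m k))"
  by (simp add: rademacher_def cis_conv_exp mult_ac)

lemma rademacher_add: "rademacher m k (add x y) = rademacher m k x * rademacher m k y"
proof -
  define s where "s = x k + y k"
  have "real s = real (s mod m k) + real (m k) * real (s div m k)"
    by (metis mod_mult_div_eq of_nat_add of_nat_mult)
  then have "2 * pi * real s / real (m k) = 2 * pi * real (s mod m k) / real (m k) + 2 * pi * real (s div m k)"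
    by (simp add: field_simps)
  then have "cis (2 * pi * real s / real (m k)) =
      cis (2 * pi * real (s mod m k) / real (m k)) * cis (2 * pi * real (s div m k))"
    by (simp only: cis_mult)
  also have "cis (2 * pi * real (s div m k)) = 1" by (rule cis_multiple_2pi) simp
  finally show ?thesis
    by (simp add: rademacher_eq_cis vilenkin_add_def s_def cis_mult ring_distribs add_divide_distrib)
qed

lemma psi_prod: "n \<le> K \<Longrightarrow> \<psi> n x = (\<Prod>k<K. rademacher m k x ^ digit n k)"
  using m_ge by (rule vilenkin_fun_finite_prod)

lemma psi_add: "\<psi> n (add x y) = \<psi> n x * \<psi> n y"
  by (simp add: psi_prod[OF order_refl] rademacher_add power_mult_distrib prod.distrib)

lemma norm_psi [simp]: "cmod (\<psi> n x) = 1"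
  by (simp add: psi_prod[OF order_refl] rademacher_eq_cis norm_power flip: prod_norm)

lemma psi_nonzero [simp]: "\<psi> n x \<noteq> 0"
  using norm_psi[of n x] by force

lemma psi_block_add:
  assumes "i < M J"
  shows "\<psi> (u * M J + i) x = \<psi> (u * M J) x * \<psi> i x"
  using assms
  by (simp add: psi_prod[of _ "u * M J + i"] digit_block_add power_add prod.distrib)

lemma psi_small:
  assumes "i < M J"
  shows "\<psi> i x = (\<Prod>t<J. rademacher m t x ^ digit i t)"
proof -
  have "\<psi> i x = (\<Prod>t<i + J. rademacher m t x ^ digit i t)" by (intro psi_prod) simp
  also have "\<dots> = (\<Prod>t<J. rademacher m t x ^ digit i t)"
    using assms by (intro prod.mono_neutral_right) (auto simp: digit_small not_less)
  finally show ?thesis .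
qed

lemma psi_eq_1:
  assumes "i < M J" and "\<And>t. t < J \<Longrightarrow> x t = 0"
  shows "\<psi> i x = 1"
  using assms(2) by (simp add: psi_small[OF assms(1)] rademacher_eq_cis)

lemma psi_mult_M:
  assumes v: "v < m t"
  shows "\<psi> (v * M t) x = rademacher m t x ^ v"
proof -
  have d: "digit (v * M t) s = (if s = t then v else 0)" for s
  proof (cases s t rule: linorder_cases)
    case less
    then obtain c where "M t = M (Suc s) * c" using M_dvd[of "Suc s" t] by (auto elim: dvdE)
    then have c: "v * M t = M s * (m s * (v * c))" by (simp add: mult_ac)
    show ?thesis using less unfolding c vilenkin_digit_def by simp
  next
    case equal
    then show ?thesis using v by (simp add: vilenkin_digit_def)
  next
    case greater
    then show ?thesis using v by (auto intro!: digit_small[of _ "Suc t"])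
  qed
  have "\<psi> (v * M t) x = (\<Prod>s<Suc t. rademacher m s x ^ digit (v * M t) s)"
    using v by (intro psi_small) auto
  also have "\<dots> = rademacher m t x ^ v" by (simp add: d)
  finally show ?thesis .
qed

definition unit_seq :: "nat \<Rightarrow> nat \<Rightarrow> nat" where
  "unit_seq a = (\<lambda>k. if k = a then 1 else 0)"

definition zero_seq :: "nat \<Rightarrow> nat" where "zero_seq = (\<lambda>k. 0)"

lemma unit_seq_in_G: "unit_seq a \<in> G"
  using m_ge by (auto simp: vilenkin_group_def unit_seq_def Suc_le_eq numeral_2_eq_2)

lemma zero_seq_in_G: "zero_seq \<in> G"
  by (simp add: vilenkin_group_def zero_seq_def)

lemma psi_zero_seq [simp]: "\<psi> i zero_seq = 1"
  by (rule psi_eq_1[OF less_M]) (simp add: zero_seq_def)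

lemma psi_unit_seq: "\<psi> i (unit_seq a) = cis (2 * pi * real (digit i a) / real (m a))"
proof -
  have "\<psi> i (unit_seq a) = (\<Prod>t<i + Suc a. rademacher m t (unit_seq a) ^ digit i t)"
    by (intro psi_prod) simp
  also have "\<dots> = (\<Prod>t\<in>{a}. rademacher m t (unit_seq a) ^ digit i t)"
    by (intro prod.mono_neutral_right) (auto simp: unit_seq_def rademacher_eq_cis)
  also have "\<dots> = cis (2 * pi * real (digit i a) / real (m a))"
    by (simp add: unit_seq_def rademacher_eq_cis Complex.DeMoivre mult_ac)
  finally show ?thesis .
qed

text \<open>Distinct indices differ in some digit \<open>a\<close>, and the generator of the \<open>a\<close>-th factor of the group sees
  exactly this digit.\<close>
lemma psi_separated:
  assumes "i \<noteq> j"
  obtains a where "\<psi> i (unit_seq a) \<noteq> \<psi> j (unit_seq a)"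
proof -
  obtain a where a: "digit i a \<noteq> digit j a" using assms digit_eqI by blast
  have "inj_on (\<lambda>k. cis (2 * pi * real k / real (m a))) {..<m a}"
    by (rule inj_on_cis_root_unity) simp
  moreover have "digit i a < m a" "digit j a < m a" by (simp_all add: vilenkin_digit_def)
  ultimately have "\<psi> i (unit_seq a) \<noteq> \<psi> j (unit_seq a)"
    using a unfolding psi_unit_seq inj_on_def by blast
  then show thesis by (rule that)
qed

lemma psi_block_unit_seq:
  assumes "i \<in> {M a..<2 * M a}"
  shows "\<psi> i (unit_seq a) \<noteq> 1"
proof -
  from inj_onD[OF inj_on_cis_root_unity[OF m_pos[of a]], of 1 0] show ?thesis
    using m_ge[of a] by (auto simp: psi_unit_seq digit_block[OF assms])
qed

section \<open>Dirichlet kernels\<close>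

definition dirichlet_kernel :: "nat \<Rightarrow> (nat \<Rightarrow> nat) \<Rightarrow> complex" where
  "dirichlet_kernel n x = (\<Sum>i<n. \<psi> i x)"

lemma sum_psi_blocks: "(\<Sum>i<u * M J. \<psi> i x) = (\<Sum>v<u. \<psi> (v * M J) x) * dirichlet_kernel (M J) x"
proof -
  have "(\<Sum>i<u * M J. \<psi> i x) = (\<Sum>v<u. \<Sum>i<M J. \<psi> (v * M J + i) x)"
    by (induction u) (simp_all add: sum_lessThan_add add.commute[of "M J"])
  also have "\<dots> = (\<Sum>v<u. \<Sum>i<M J. \<psi> (v * M J) x * \<psi> i x)"
    by (intro sum.cong refl) (simp add: psi_block_add)
  finally show ?thesis by (simp only: dirichlet_kernel_def sum_product)
qed

text \<open>If \<open>x t \<noteq> 0\<close> with \<open>t < J\<close>, then the sum splits off the factor \<open>\<Sum>v<m t. w ^ v\<close> with the nontrivial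
  \<open>m t\<close>-th root of unity \<open>w = rademacher m t x\<close>, and this factor is zero.\<close>
lemma dirichlet_kernel_M:
  assumes "x \<in> G"
  shows "dirichlet_kernel (M J) x = (if \<forall>t<J. x t = 0 then of_nat (M J) else 0)"
proof (cases "\<forall>t<J. x t = 0")
  case True
  then show ?thesis using psi_eq_1[of _ J x] by (simp add: dirichlet_kernel_def)
next
  case False
  then obtain t where t: "t < J" "x t \<noteq> 0" by blast
  have c: "dirichlet_kernel (M (Suc t)) x = 0"
  proof -
    have mu: "M (Suc t) = m t * M t" by simp
    define w where "w = rademacher m t x"
    have p: "\<psi> (v * M t) x = w ^ v" if "v < m t" for v
      using that unfolding w_def by (rule psi_mult_M)
    have "w ^ m t = 1" by (simp add: w_def rademacher_eq_cis Complex.DeMoivre)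
    moreover have "w \<noteq> 1"
    proof -
      from inj_onD[OF inj_on_cis_root_unity[OF m_pos[of t]], of "x t" 0] show ?thesis
        using t(2) assms by (auto simp: w_def rademacher_eq_cis vilenkin_group_def)
    qed
    ultimately have "(\<Sum>v<m t. w ^ v) = 0" by (simp add: geometric_sum)
    then have "(\<Sum>v<m t. \<psi> (v * M t) x) = 0" using p by simp
    then show ?thesis
      using sum_psi_blocks[of x "m t" t] unfolding mu dirichlet_kernel_def by simp
  qed
  have "M (Suc t) dvd M J" using t by (intro M_dvd) simp
  then obtain u where "M J = u * M (Suc t)" by (metis dvd_def mult.commute)
  then have "dirichlet_kernel (M J) x = 0"
    using sum_psi_blocks[of x u "Suc t"] c unfolding dirichlet_kernel_def by simp
  then show ?thesis using False by auto
qed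

text \<open>Complete groups of \<open>M (Suc j)\<close> characters sum to zero at \<open>x\<close> because \<open>x\<close> lies outside the cylinder of
  length \<open>Suc j\<close>. In the incomplete last group there are at most \<open>M j\<close> characters; up to the common
  factor \<open>\<psi> (u * M (Suc j))\<close> they only involve the first \<open>j\<close> coordinates of \<open>x\<close>, which are zero, so
  they do not cancel at all.\<close>
lemma norm_dirichlet_kernel:
  assumes x: "x \<in> G" "\<And>t. t < j \<Longrightarrow> x t = 0" "x j \<noteq> 0" and n: "n mod M (Suc j) \<le> M j"
  shows "cmod (dirichlet_kernel n x) = real (n mod M (Suc j))"
proof -
  define u where "u = n div M (Suc j)"
  define r where "r = n mod M (Suc j)"
  have n_eq: "n = u * M (Suc j) + r" unfolding u_def r_def by (simp only: div_mult_mod_eq)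
  have r: "r < M (Suc j)" unfolding r_def by (rule mod_less_divisor) (rule M_pos)
  have "dirichlet_kernel n x = (\<Sum>i<u * M (Suc j). \<psi> i x) + (\<Sum>i<r. \<psi> (u * M (Suc j) + i) x)"
    unfolding dirichlet_kernel_def n_eq by (rule sum_lessThan_add)
  also have "(\<Sum>i<u * M (Suc j). \<psi> i x) = 0"
    using x by (subst sum_psi_blocks) (auto simp: dirichlet_kernel_M simp del: vilenkin_base.simps)
  also have "(\<Sum>i<r. \<psi> (u * M (Suc j) + i) x) = (\<Sum>i<r. \<psi> (u * M (Suc j)) x)"
  proof (intro sum.cong refl)
    fix i assume i: "i \<in> {..<r}"
    have "\<psi> i x = 1" using i n x(2) by (intro psi_eq_1[of _ j]) (auto simp: r_def)
    then show "\<psi> (u * M (Suc j) + i) x = \<psi> (u * M (Suc j)) x"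
      using i r by (subst psi_block_add) auto
  qed
  finally show ?thesis by (simp add: r_def norm_mult del: vilenkin_base.simps)
qed

section \<open>Translation invariance and orthogonality\<close>

sublocale mu: prob_space "vilenkin_measure m"
  using m_ge by (rule prob_space_vilenkin_measure)

sublocale mu2: prob_space "vilenkin_measure2 m"
  using m_ge by (rule prob_space_vilenkin_measure2)

lemma coordinate_measurable: "(\<lambda>x. x k) \<in> \<mu> \<rightarrow>\<^sub>M uniform_count_measure {0..<m k}"
  unfolding vilenkin_measure_def by (rule measurable_component_singleton) simp

lemma psi_measurable [measurable]: "\<psi> n \<in> borel_measurable \<mu>"
proof -
  have "rademacher m k \<in> borel_measurable \<mu>" for k
    unfolding rademacher_def
    by (rule measurable_compose[OF coordinate_measurable])
      (simp add: measurable_def sets_uniform_count_measure space_uniform_count_measure)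
  then have "(\<lambda>x. \<Prod>k<n. rademacher m k x ^ digit n k) \<in> borel_measurable \<mu>" by measurable
  moreover have "\<psi> n = (\<lambda>x. \<Prod>k<n. rademacher m k x ^ digit n k)"
    using psi_prod[OF order_refl] by blast
  ultimately show ?thesis by simp
qed

lemma fst_measurable [measurable]: "fst \<in> \<mu>2 \<rightarrow>\<^sub>M \<mu>"
  and snd_measurable [measurable]: "snd \<in> \<mu>2 \<rightarrow>\<^sub>M \<mu>"
  by (simp_all add: vilenkin_measure2_def)

lemma psi_measurable2 [measurable]:
  "(\<lambda>z. \<psi> n (fst z)) \<in> borel_measurable \<mu>2" "(\<lambda>z. \<psi> n (snd z)) \<in> borel_measurable \<mu>2"
  by (auto intro: measurable_compose[OF fst_measurable psi_measurable]
      measurable_compose[OF snd_measurable psi_measurable])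

lemma cnj_measurable [measurable]: "cnj \<in> borel_measurable borel"
  by (intro borel_measurable_continuous_onI continuous_intros)

lemma add_in_G: "e \<in> G \<Longrightarrow> x \<in> G \<Longrightarrow> add e x \<in> G"
  by (simp add: vilenkin_add_def vilenkin_group_def)

lemma add_measurable: "add e \<in> \<mu> \<rightarrow>\<^sub>M \<mu>"
proof -
  have "(\<lambda>x. (e k + x k) mod m k) \<in> \<mu> \<rightarrow>\<^sub>M uniform_count_measure {0..<m k}" for k
    by (rule measurable_compose[OF coordinate_measurable])
      (auto simp: measurable_def sets_uniform_count_measure space_uniform_count_measure)
  then show ?thesis
    unfolding vilenkin_add_def
    by (subst (2) vilenkin_measure_def, intro measurable_PiM_single')
      (auto simp: space_uniform_count_measure)
qed

lemma distr_add2: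
  assumes "e \<in> G" "e' \<in> G"
  shows "distr \<mu>2 \<mu>2 (\<lambda>z. (add e (fst z), add e' (snd z))) = \<mu>2"
proof -
  have t: "distr \<mu> \<mu> (add a) = \<mu>" if "a \<in> G" for a
    using m_ge that by (rule vilenkin_measure_translation)
  have "distr \<mu> \<mu> (add e) \<Otimes>\<^sub>M distr \<mu> \<mu> (add e') =
      distr (\<mu> \<Otimes>\<^sub>M \<mu>) (\<mu> \<Otimes>\<^sub>M \<mu>) (\<lambda>(x, y). (add e x, add e' y))"
    by (rule pair_measure_distr) (simp_all add: add_measurable t assms mu.sigma_finite_measure_axioms)
  then show ?thesis
    unfolding vilenkin_measure2_def t[OF assms(1)] t[OF assms(2)] case_prod_unfold by (rule sym)
qed

text \<open>By translation invariance the integral equals \<open>w\<close> times itself. This one observation gives both the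
  orthogonality of the characters and the martingale property below.\<close>
lemma integral_eq_0_if_twisted_by_translation:
  fixes h :: "_ \<Rightarrow> complex"
  assumes e: "e \<in> G" "e' \<in> G" and h: "h \<in> borel_measurable \<mu>2" and w: "w \<noteq> 1"
    and twist: "\<And>x y. x \<in> G \<Longrightarrow> y \<in> G \<Longrightarrow> h (add e x, add e' y) = w * h (x, y)"
  shows "integral\<^sup>L \<mu>2 h = 0"
proof -
  have T: "(\<lambda>z. (add e (fst z), add e' (snd z))) \<in> \<mu>2 \<rightarrow>\<^sub>M \<mu>2"
    unfolding vilenkin_measure2_def
    by (intro measurable_Pair measurable_compose[OF _ add_measurable] measurable_fst measurable_snd)
  have "integral\<^sup>L \<mu>2 h = integral\<^sup>L (distr \<mu>2 \<mu>2 (\<lambda>z. (add e (fst z), add e' (snd z)))) h"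
    by (simp add: distr_add2 e)
  also have "\<dots> = (\<integral>z. h (add e (fst z), add e' (snd z)) \<partial>\<mu>2)"
    using T h by (rule integral_distr)
  also have "\<dots> = (\<integral>z. w * h z \<partial>\<mu>2)"
    by (intro Bochner_Integration.integral_cong refl)
      (auto simp: space_vilenkin_measure2 twist)
  also have "\<dots> = w * integral\<^sup>L \<mu>2 h" by simp
  finally have "(1 - w) * integral\<^sup>L \<mu>2 h = 0" by (simp add: algebra_simps)
  then show ?thesis using w by simp
qed

lemma psi_orthonormal:
  "(\<integral>z. \<psi> i (fst z) * \<psi> j (snd z) * cnj (\<psi> i' (fst z)) * cnj (\<psi> j' (snd z)) \<partial>\<mu>2)
    = of_bool (i = i' \<and> j = j')"
proof -
  let ?h = "\<lambda>z. \<psi> i (fst z) * \<psi> j (snd z) * cnj (\<psi> i' (fst z)) * cnj (\<psi> j' (snd z))"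
  have psi_cnj: "\<psi> n x * cnj (\<psi> n x) = 1" for n x
    by (metis norm_psi complex_norm_square of_real_1 power_one)
  have neq: "u * cnj v \<noteq> 1" if "u \<noteq> v" "cmod v = 1" for u v
  proof
    assume "u * cnj v = 1"
    then have "u * (cnj v * v) = v" by (metis mult.assoc mult_1)
    moreover have "cnj v * v = 1"
      using that(2) by (metis complex_norm_square mult.commute of_real_1 power_one)
    ultimately show False using that by simp
  qed
  have meas: "?h \<in> borel_measurable \<mu>2" by measurable
  consider "i = i' \<and> j = j'" | "i \<noteq> i'" | "j \<noteq> j'" by blast
  then show ?thesis
  proof cases
    case 1
    have "?h z = 1" for z
      using 1 psi_cnj[of i "fst z"] psi_cnj[of j "snd z"]
      by (metis (no_types, lifting) mult.assoc mult.commute mult_1)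
    then show ?thesis using 1 by (simp add: mu2.prob_space)
  next
    case 2
    then obtain a where a: "\<psi> i (unit_seq a) \<noteq> \<psi> i' (unit_seq a)" by (rule psi_separated)
    have "integral\<^sup>L \<mu>2 ?h = 0"
      by (rule integral_eq_0_if_twisted_by_translation[OF unit_seq_in_G zero_seq_in_G meas neq[OF a norm_psi]])
        (simp add: psi_add mult_ac)
    then show ?thesis using 2 by simp
  next
    case 3
    then obtain a where a: "\<psi> j (unit_seq a) \<noteq> \<psi> j' (unit_seq a)" by (rule psi_separated)
    have "integral\<^sup>L \<mu>2 ?h = 0"
      by (rule integral_eq_0_if_twisted_by_translation[OF zero_seq_in_G unit_seq_in_G meas neq[OF a norm_psi]])
        (simp add: psi_add mult_ac)
    then show ?thesis using 3 by simp
  qed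
qed

section \<open>Cylinders and square algebras\<close>

abbreviation "cylinder n \<equiv> vilenkin_interval m n zero_seq"

lemma mem_cylinder: "x \<in> cylinder n \<longleftrightarrow> x \<in> G \<and> (\<forall>t<n. x t = 0)"
  by (simp add: vilenkin_interval_def zero_seq_def)

lemma emeasure_cylinder: "emeasure \<mu> (cylinder n) = ennreal (1 / real (M n))"
proof -
  define U where "U = (\<lambda>k. uniform_count_measure {0..<m k})"
  have U: "prob_space (U k)" for k
    unfolding U_def by (rule prob_space_uniform_count_measure) auto
  have "cylinder n = prod_emb UNIV U {..<n} (\<Pi>\<^sub>E k\<in>{..<n}. {0})"
    by (auto simp: mem_cylinder prod_emb_def space_PiM U_def space_uniform_count_measure
        PiE_iff vilenkin_group_def fun_eq_iff restrict_apply split: if_splits)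
  then have "emeasure \<mu> (cylinder n) = (\<Prod>k<n. emeasure (U k) {0})"
    unfolding vilenkin_measure_def U_def[symmetric]
    by (simp only:) (rule emeasure_PiM_emb[OF U], auto simp: U_def sets_uniform_count_measure)
  also have "\<dots> = (\<Prod>k<n. ennreal (1 / real (m k)))"
    by (simp add: U_def emeasure_uniform_count_measure)
  also have "\<dots> = ennreal (1 / real (M n))"
    by (induction n) (simp_all flip: ennreal_mult')
  finally show ?thesis .
qed

lemma measure_cylinder: "measure \<mu> (cylinder n) = 1 / real (M n)"
  by (simp add: measure_def emeasure_cylinder)

lemma measure_shell: "measure \<mu> (cylinder n - cylinder (Suc n)) \<ge> 1 / (2 * real (M n))"
proof -
  have "measure \<mu> (cylinder n - cylinder (Suc n)) = 1 / real (M n) - 1 / real (M (Suc n))"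
    unfolding measure_cylinder[symmetric] by (intro mu.finite_measure_Diff) (auto simp: mem_cylinder)
  moreover have "1 / real (M (Suc n)) \<le> 1 / (2 * real (M n))"
    using m_ge[of n] by (intro divide_left_mono) auto
  moreover have "1 / (2 * real (M n)) = 1 / real (M n) / 2" by simp
  ultimately show ?thesis by linarith
qed

lemma square_generators_subset:
  "{vilenkin_interval m n x \<times> vilenkin_interval m n y | x y. x \<in> G \<and> y \<in> G} \<subseteq> Pow (G \<times> G)"
  by (auto simp: vilenkin_interval_def)

lemma sets_square_algebra: "sets (square_algebra m n) = sigma_sets (G \<times> G)
    {vilenkin_interval m n x \<times> vilenkin_interval m n y | x y. x \<in> G \<and> y \<in> G}"
  by (simp add: square_algebra_def sets_measure_of[OF square_generators_subset])

lemma space_square_algebra: "space (square_algebra m n) = G \<times> G"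
  using subalgebra_square_algebra[of m n] by (simp add: subalgebra_def space_vilenkin_measure2)

text \<open>Two points agree up to \<open>n\<close> iff they lie in the same square of the \<open>n\<close>-th level.\<close>
definition agree :: "nat \<Rightarrow> _ \<Rightarrow> _ \<Rightarrow> bool" where
  "agree n z w \<longleftrightarrow> (\<forall>t<n. fst z t = fst w t \<and> snd z t = snd w t)"

text \<open>The sets of the algebra are unions of squares, hence saturated for \<open>agree n\<close>.\<close>
lemma square_algebra_saturated:
  assumes "A \<in> sets (square_algebra m n)" "z \<in> G \<times> G" "w \<in> G \<times> G" "agree n z w"
  shows "z \<in> A \<longleftrightarrow> w \<in> A"
proof -
  have "A \<in> sigma_sets (G \<times> G) {vilenkin_interval m n x \<times> vilenkin_interval m n y | x y. x \<in> G \<and> y \<in> G}"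
    using assms(1) by (simp only: sets_square_algebra)
  then show ?thesis
  proof (induction rule: sigma_sets.induct)
    case (Basic A)
    then show ?case using assms(2-4)
      by (auto simp: vilenkin_interval_def agree_def mem_Times_iff)
  qed (use assms in auto)
qed

text \<open>There are only finitely many squares of the \<open>n\<close>-th level, so every union of them is measurable.\<close>
lemma square_algebra_measurableI:
  assumes "\<And>z w. z \<in> G \<times> G \<Longrightarrow> w \<in> G \<times> G \<Longrightarrow> agree n z w \<Longrightarrow> f z = f w"
  shows "f \<in> measurable (square_algebra m n) (borel :: complex measure)"
proof (rule measurableI)
  fix B :: "complex set" assume "B \<in> sets borel"
  let ?Q = "\<lambda>z. vilenkin_interval m n (fst z) \<times> vilenkin_interval m n (snd z)"
  let ?P = "f -` B \<inter> space (square_algebra m n)"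
  define C where "C = ?Q ` ?P"
  have P_eq: "?P = \<Union> C"
    unfolding C_def
  proof (intro equalityI subsetI)
    fix z assume "z \<in> ?P"
    moreover from this have "z \<in> ?Q z"
      by (auto simp: space_square_algebra vilenkin_interval_def mem_Times_iff)
    ultimately show "z \<in> \<Union> (?Q ` ?P)" by blast
  next
    fix z assume "z \<in> \<Union> (?Q ` ?P)"
    then obtain w where w: "w \<in> ?P" "z \<in> ?Q w" by blast
    then have "z \<in> G \<times> G" "w \<in> G \<times> G" "agree n z w"
      by (auto simp: vilenkin_interval_def agree_def mem_Times_iff space_square_algebra)
    with assms[of z w] w show "z \<in> ?P" by (auto simp: space_square_algebra)
  qed
  have "finite C"
    unfolding C_def
  proof (rule finite_subset)
    show "?Q ` ?P \<subseteq> (\<lambda>(A, B). A \<times> B) ` ((vilenkin_interval m n ` G) \<times> (vilenkin_interval m n ` G))"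
      by (auto simp: space_square_algebra)
    show "finite \<dots>"
      by (intro finite_imageI finite_cartesian_product finite_vilenkin_intervals)
  qed
  moreover have "C \<subseteq> sets (square_algebra m n)"
  proof
    fix S assume "S \<in> C"
    then obtain z where "S = ?Q z" "fst z \<in> G" "snd z \<in> G"
      by (auto simp: space_square_algebra C_def)
    then show "S \<in> sets (square_algebra m n)"
      unfolding sets_square_algebra by (intro sigma_sets.Basic) blast
  qed
  ultimately show "?P \<in> sets (square_algebra m n)"
    unfolding P_eq by (rule sets.finite_Union)
qed simp

section \<open>Lebesgue constants\<close>

lemma cylinder_square_sets [measurable]: "cylinder a \<times> cylinder a \<in> sets \<mu>2"
  unfolding vilenkin_measure2_def by (intro pair_measureI vilenkin_interval_sets)

lemma emeasure_Times:
  assumes "A \<in> sets \<mu>"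
  shows "emeasure \<mu>2 (A \<times> A) = ennreal ((measure \<mu> A)\<^sup>2)"
  using assms
  by (simp add: vilenkin_measure2_def mu.emeasure_pair_measure_Times mu.emeasure_eq_measure
      power2_eq_square ennreal_mult)

lemma dirichlet_kernel_measurable [measurable]: "dirichlet_kernel n \<in> borel_measurable \<mu>"
  unfolding dirichlet_kernel_def by measurable

lemma norm_dirichlet_kernel_le: "cmod (dirichlet_kernel n x) \<le> real n"
proof -
  have "cmod (dirichlet_kernel n x) \<le> (\<Sum>i<n. cmod (\<psi> i x))"
    unfolding dirichlet_kernel_def by (rule norm_sum)
  then show ?thesis by simp
qed

definition lebesgue_constant :: "nat \<Rightarrow> real" where
  "lebesgue_constant n = (\<integral>x. cmod (dirichlet_kernel n x) \<partial>\<mu>)"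

lemma dirichlet_kernel_integrable: "integrable \<mu> (\<lambda>x. cmod (dirichlet_kernel n x))"
proof -
  show ?thesis
    by (intro mu.integrable_const_bound[of _ "real n"]) (auto simp: norm_dirichlet_kernel_le)
qed

text \<open>The product structure of the kernel makes its norm a square; this is where the exponent \<open>2\<close> of the
  logarithm in the second part comes from.\<close>
lemma nn_integral_dirichlet_square:
  "(\<integral>\<^sup>+z. ennreal (cmod (dirichlet_kernel n (fst z)) * cmod (dirichlet_kernel n (snd z))) \<partial>\<mu>2)
     = ennreal ((lebesgue_constant n)\<^sup>2)"
proof -
  let ?d = "\<lambda>x. ennreal (cmod (dirichlet_kernel n x))"
  have L: "(\<integral>\<^sup>+x. ?d x \<partial>\<mu>) = ennreal (lebesgue_constant n)"
    unfolding lebesgue_constant_def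
    by (rule nn_integral_eq_integral[OF dirichlet_kernel_integrable]) simp
  have "(\<integral>\<^sup>+z. ennreal (cmod (dirichlet_kernel n (fst z)) * cmod (dirichlet_kernel n (snd z))) \<partial>\<mu>2)
      = (\<integral>\<^sup>+z. ?d (fst z) * ?d (snd z) \<partial>(\<mu> \<Otimes>\<^sub>M \<mu>))"
    by (simp add: ennreal_mult vilenkin_measure2_def)
  also have "\<dots> = (\<integral>\<^sup>+x. \<integral>\<^sup>+y. ?d x * ?d y \<partial>\<mu> \<partial>\<mu>)"
    by (subst mu.nn_integral_fst[symmetric]) simp_all
  also have "\<dots> = ennreal (lebesgue_constant n) * ennreal (lebesgue_constant n)"
    by (simp add: nn_integral_cmult nn_integral_multc L)
  also have "\<dots> = ennreal ((lebesgue_constant n)\<^sup>2)"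
    by (simp add: power2_eq_square ennreal_mult lebesgue_constant_def)
  finally show ?thesis .
qed

text \<open>The points with exactly \<open>j\<close> leading zeros.\<close>
definition shell :: "nat \<Rightarrow> (nat \<Rightarrow> nat) set" where
  "shell j = cylinder j - cylinder (Suc j)"

lemma shell_sets [measurable]: "shell j \<in> sets \<mu>"
  unfolding shell_def by (intro sets.Diff vilenkin_interval_sets)

lemma mem_shell: "x \<in> shell j \<longleftrightarrow> x \<in> G \<and> (\<forall>t<j. x t = 0) \<and> x j \<noteq> 0"
  by (auto simp: shell_def mem_cylinder less_Suc_eq)

text \<open>On the \<open>j\<close>-th shell the kernel has modulus \<open>n mod M (Suc j)\<close> if this number is at most \<open>M j\<close>; larger
  residues are simply discarded.\<close>
lemma lebesgue_constant_ge:
  defines "d \<equiv> \<lambda>j r. if r \<le> M j then real r else 0"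
  shows "(\<Sum>j<A. d j (n mod M (Suc j)) * measure \<mu> (shell j)) \<le> lebesgue_constant n"
proof -
  have int: "integrable \<mu> (\<lambda>x. b * indicator (shell j) x)" for b :: real and j
    by (intro integrable_mult_right integrable_real_indicator) (auto simp: mu.emeasure_eq_measure)
  have "(\<Sum>j<A. d j (n mod M (Suc j)) * measure \<mu> (shell j))
      = (\<integral>x. (\<Sum>j<A. d j (n mod M (Suc j)) * indicator (shell j) x) \<partial>\<mu>)"
    by (subst Bochner_Integration.integral_sum, rule int) (simp add: sets.Int_space_eq2[OF shell_sets])
  also have "\<dots> \<le> lebesgue_constant n"
    unfolding lebesgue_constant_def
  proof (rule integral_mono[OF _ dirichlet_kernel_integrable])
    show "integrable \<mu> (\<lambda>x. \<Sum>j<A. d j (n mod M (Suc j)) * indicator (shell j) x)"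
      by (intro Bochner_Integration.integrable_sum int)
    fix x
    show "(\<Sum>j<A. d j (n mod M (Suc j)) * indicator (shell j) x) \<le> cmod (dirichlet_kernel n x)"
    proof (cases "\<exists>j<A. x \<in> shell j")
      case True
      then obtain j where j: "j < A" "x \<in> shell j" by blast
      \<comment> \<open>the shells are disjoint, so at most one summand is nonzero\<close>
      have other: "x \<notin> shell i" if "i \<noteq> j" for i
        using j(2) that by (cases i j rule: linorder_cases) (auto simp: mem_shell)
      have "(\<Sum>i<A. d i (n mod M (Suc i)) * indicator (shell i) x)
          = (\<Sum>i\<in>{j}. d i (n mod M (Suc i)) * indicator (shell i) x)"
        using j other by (intro sum.mono_neutral_right) auto
      also have "\<dots> = d j (n mod M (Suc j))" using j by simp
      also have "\<dots> \<le> cmod (dirichlet_kernel n x)"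
        using j norm_dirichlet_kernel[of x j n] by (auto simp: d_def mem_shell simp del: vilenkin_base.simps)
      finally show ?thesis .
    next
      case False
      then have "(\<Sum>j<A. d j (n mod M (Suc j)) * indicator (shell j) x) = 0"
        by (intro sum.neutral) auto
      then show ?thesis by simp
    qed
  qed
  finally show ?thesis .
qed

text \<open>Exchange the order of summation: for fixed \<open>j\<close>, the residues \<open>n mod M (Suc j)\<close> are equidistributed, a
  proportion of about \<open>1 / m j\<close> of them is at most \<open>M j\<close>, and these have mean \<open>M j / 2\<close>. This is multiplied by the
  measure of the shell, at least \<open>1 / (2 * M j)\<close>, so that every \<open>j < A\<close> contributes at least
  \<open>1 / (4 * B)\<close> to the mean.\<close>
lemma sum_lebesgue_constant_ge:
  assumes B: "\<And>k. m k \<le> B"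
  shows "real A * real (M A) / (4 * real B) \<le> (\<Sum>n<M A. lebesgue_constant n)"
proof -
  define d where "d = (\<lambda>j r. if r \<le> M j then real r else 0)"
  have B0: "B > 0" using B[of 0] m_pos[of 0] by linarith
  have per: "real (M A) / (4 * real B) \<le> (\<Sum>n<M A. d j (n mod M (Suc j)) * measure \<mu> (shell j))"
    if j: "j < A" for j
  proof -
    have "M (Suc j) dvd M A" using j by (intro M_dvd) simp
    then obtain q where q: "M A = q * M (Suc j)" by (metis dvd_def mult.commute)
    have "(real (M j))\<^sup>2 / 2 \<le> (\<Sum>r\<le>M j. real r)"
      using double_gauss_sum[of "M j", where 'a = real] by (simp add: atMost_atLeast0 power2_eq_square field_simps)
    also have "\<dots> = (\<Sum>r\<le>M j. d j r)" by (intro sum.cong) (auto simp: d_def)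
    also have "\<dots> \<le> (\<Sum>r<M (Suc j). d j r)"
    proof (rule sum_mono2)
      have "M j < M (Suc j)" using double_M_le[of j "Suc j"] M_pos[of j] by linarith
      then show "{..M j} \<subseteq> {..<M (Suc j)}" by (auto simp del: vilenkin_base.simps)
    qed (auto simp: d_def)
    finally have "real q * ((real (M j))\<^sup>2 / 2) \<le> (\<Sum>n<M A. d j (n mod M (Suc j)))"
      unfolding q by (subst sum_mod_period) (intro mult_left_mono, simp_all)
    then have "real q * ((real (M j))\<^sup>2 / 2) * (1 / (2 * real (M j)))
        \<le> (\<Sum>n<M A. d j (n mod M (Suc j))) * measure \<mu> (shell j)"
      using measure_shell[of j] by (intro mult_mono sum_nonneg) (auto simp: shell_def d_def)
    moreover have "real (M A) / (4 * real B) \<le> real q * ((real (M j))\<^sup>2 / 2) * (1 / (2 * real (M j)))"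
    proof -
      have "real (M A) = real q * real (M j) * real (m j)" by (simp add: q)
      also have "\<dots> \<le> real q * real (M j) * real B" using B[of j] by (intro mult_left_mono) auto
      finally show ?thesis using B0 by (simp add: field_simps power2_eq_square)
    qed
    ultimately show ?thesis by (simp add: sum_distrib_right)
  qed
  have "real A * real (M A) / (4 * real B) = (\<Sum>j<A. real (M A) / (4 * real B))" by simp
  also have "\<dots> \<le> (\<Sum>j<A. \<Sum>n<M A. d j (n mod M (Suc j)) * measure \<mu> (shell j))"
    by (intro sum_mono per) simp
  also have "\<dots> = (\<Sum>n<M A. \<Sum>j<A. d j (n mod M (Suc j)) * measure \<mu> (shell j))"
    by (rule sum.swap)
  also have "\<dots> \<le> (\<Sum>n<M A. lebesgue_constant n)"
    unfolding d_def by (intro sum_mono lebesgue_constant_ge)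
  finally show ?thesis .
qed

lemma sum_lebesgue_constant_square_ge:
  assumes B: "\<And>k. m k \<le> B"
  shows "real (M A) * (real A / (4 * real B))\<^sup>2 \<le> (\<Sum>n<M A. (lebesgue_constant n)\<^sup>2)"
proof -
  have "(real A * real (M A) / (4 * real B))\<^sup>2 \<le> (\<Sum>n<M A. lebesgue_constant n)\<^sup>2"
    using sum_lebesgue_constant_ge[OF B, of A] by (intro power_mono) auto
  also have "\<dots> \<le> (\<Sum>n<M A. (lebesgue_constant n)\<^sup>2) * real (M A)"
    using sum_squared_le_sum_of_squares[of lebesgue_constant "{..<M A}"] by simp
  finally have "real (M A) * (real (M A) * (real A / (4 * real B))\<^sup>2)
      \<le> real (M A) * (\<Sum>n<M A. (lebesgue_constant n)\<^sup>2)"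
    by (simp add: power2_eq_square mult_ac)
  then show ?thesis by simp
qed

section \<open>Blocks of characters\<close>

definition block_poly :: "nat \<Rightarrow> (nat \<Rightarrow> nat) \<Rightarrow> complex" where
  "block_poly a x = (\<Sum>i\<in>{M a..<2 * M a}. \<psi> i x)"

lemma block_partial_sum:
  assumes "l \<le> M a"
  shows "(\<Sum>i\<in>{M a..<M a + l}. \<psi> i x) = \<psi> (M a) x * dirichlet_kernel l x"
proof -
  have "(\<Sum>i\<in>{M a..<M a + l}. \<psi> i x) = (\<Sum>i<l. \<psi> (1 * M a + i) x)"
    using sum.shift_bounds_nat_ivl[of "\<lambda>i. \<psi> i x" 0 "M a" l]
    by (simp add: add.commute atLeast0LessThan)
  also have "\<dots> = (\<Sum>i<l. \<psi> (M a) x * \<psi> i x)"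
    using assms by (intro sum.cong refl, subst psi_block_add) auto
  finally show ?thesis by (simp add: dirichlet_kernel_def sum_distrib_left)
qed

text \<open>The block is \<open>\<psi> (M a)\<close> times the Dirichlet kernel of order \<open>M a\<close>.\<close>
lemma norm_block_poly:
  assumes "x \<in> G"
  shows "cmod (block_poly a x) = real (M a) * indicator (cylinder a) x"
proof -
  have "block_poly a x = \<psi> (M a) x * dirichlet_kernel (M a) x"
    using block_partial_sum[of "M a" a x] by (simp add: block_poly_def mult_2)
  then show ?thesis using assms
    by (simp add: norm_mult dirichlet_kernel_M mem_cylinder indicator_def)
qed

lemma norm_block_poly_le: "cmod (block_poly a x) \<le> real (M a)"
proof -
  have "cmod (block_poly a x) \<le> (\<Sum>i\<in>{M a..<2 * M a}. cmod (\<psi> i x))"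
    unfolding block_poly_def by (rule norm_sum)
  then show ?thesis by simp
qed

definition block_atom :: "nat \<Rightarrow> (nat \<Rightarrow> nat) \<times> (nat \<Rightarrow> nat) \<Rightarrow> complex" where
  "block_atom a z = block_poly a (fst z) * block_poly a (snd z)"

lemma block_atom_measurable [measurable]: "block_atom a \<in> borel_measurable \<mu>2"
  unfolding block_atom_def block_poly_def by measurable

lemma norm_block_atom_le: "cmod (block_atom a z) \<le> (real (M a))\<^sup>2"
  unfolding block_atom_def norm_mult power2_eq_square
  by (intro mult_mono norm_block_poly_le) auto

lemma norm_block_atom:
  assumes "z \<in> G \<times> G"
  shows "cmod (block_atom a z) = (real (M a))\<^sup>2 * indicator (cylinder a \<times> cylinder a) z"
  using assms
  by (simp add: block_atom_def norm_mult norm_block_poly power2_eq_square indicator_times mem_Times_iff)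

lemma bounded_integrable2:
  fixes f :: "_ \<Rightarrow> complex"
  assumes "f \<in> borel_measurable \<mu>2" "\<And>z. cmod (f z) \<le> b"
  shows "integrable \<mu>2 f"
proof -
  show ?thesis using assms by (intro mu2.integrable_const_bound[of _ b]) auto
qed

lemma block_atom_integrable: "integrable \<mu>2 (block_atom a)"
  by (intro bounded_integrable2[where b = "(real (M a))\<^sup>2"] norm_block_atom_le block_atom_measurable)

lemma block_atom_square_measurable:
  assumes "a < n"
  shows "block_atom a \<in> borel_measurable (square_algebra m n)"
proof (rule square_algebra_measurableI)
  fix z w :: "(nat \<Rightarrow> nat) \<times> (nat \<Rightarrow> nat)" assume "agree n z w"
  have "block_poly a x = block_poly a y" if "\<And>t. t < n \<Longrightarrow> x t = y t" for x y
    unfolding block_poly_def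
  proof (intro sum.cong refl)
    fix i assume i: "i \<in> {M a..<2 * M a}"
    then have "i < M (Suc a)"
      using double_M_le[of a "Suc a"] by (simp del: vilenkin_base.simps)
    then show "\<psi> i x = \<psi> i y"
      using that assms by (simp add: psi_small rademacher_eq_cis del: vilenkin_base.simps)
  qed
  then show "block_atom a z = block_atom a w"
    using \<open>agree n z w\<close> unfolding block_atom_def agree_def by metis
qed

text \<open>Translation of the first variable by the \<open>a\<close>-th unit does not affect the set \<open>A\<close>, which only depends
  on coordinates before \<open>n \<le> a\<close>, while all characters of the block have \<open>a\<close>-th digit \<open>1\<close> and are
  multiplied by the same nontrivial root of unity.\<close>
lemma block_atom_integral_square_eq_0:
  assumes A: "A \<in> sets (square_algebra m n)" and "n \<le> a"
  shows "(\<integral>z. indicator A z *\<^sub>R block_atom a z \<partial>\<mu>2) = 0"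
proof (rule integral_eq_0_if_twisted_by_translation[OF unit_seq_in_G zero_seq_in_G])
  have "A \<in> sets \<mu>2"
    using A subalgebra_square_algebra[of m n] by (auto simp: subalgebra_def)
  then show "(\<lambda>z. indicator A z *\<^sub>R block_atom a z) \<in> borel_measurable \<mu>2" by measurable
  show "\<psi> (M a) (unit_seq a) \<noteq> 1" by (rule psi_block_unit_seq) simp
  fix x y assume xy: "x \<in> G" "y \<in> G"
  let ?x = "add (unit_seq a) x" and ?y = "add zero_seq y"
  have y: "?y = y" using xy by (auto simp: vilenkin_add_def zero_seq_def vilenkin_group_def)
  have x: "?x t = x t" if "t < n" for t
    using xy that assms(2) by (simp add: vilenkin_add_def unit_seq_def vilenkin_group_def)
  have "(?x, y) \<in> A \<longleftrightarrow> (x, y) \<in> A"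
    using xy x by (intro square_algebra_saturated[OF A]) (auto simp: add_in_G unit_seq_in_G agree_def)
  moreover have "block_poly a ?x = \<psi> (M a) (unit_seq a) * block_poly a x"
    unfolding block_poly_def sum_distrib_left
  proof (intro sum.cong refl)
    fix i assume i: "i \<in> {M a..<2 * M a}"
    have "\<psi> i (unit_seq a) = \<psi> (M a) (unit_seq a)"
      using digit_block[OF i] digit_block[of "M a" a] by (simp add: psi_unit_seq)
    then show "\<psi> i ?x = \<psi> (M a) (unit_seq a) * \<psi> i x" by (simp only: psi_add)
  qed
  ultimately show "indicator A (?x, ?y) *\<^sub>R block_atom a (?x, ?y)
      = \<psi> (M a) (unit_seq a) * (indicator A (x, y) *\<^sub>R block_atom a (x, y))"
    by (auto simp: y block_atom_def indicator_def)
qed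

lemma block_atom_fourier:
  "(\<integral>z. block_atom a z * cnj (\<psi> i (fst z)) * cnj (\<psi> j (snd z)) \<partial>\<mu>2)
     = of_bool (i \<in> {M a..<2 * M a} \<and> j \<in> {M a..<2 * M a})"
proof -
  let ?B = "{M a..<2 * M a}"
  let ?h = "\<lambda>i' j' z. \<psi> i' (fst z) * \<psi> j' (snd z) * cnj (\<psi> i (fst z)) * cnj (\<psi> j (snd z))"
  have int: "integrable \<mu>2 (?h i' j')" for i' j'
    by (rule bounded_integrable2[where b = 1]) (measurable, simp add: norm_mult)
  have "(\<integral>z. block_atom a z * cnj (\<psi> i (fst z)) * cnj (\<psi> j (snd z)) \<partial>\<mu>2)
      = (\<integral>z. (\<Sum>i'\<in>?B. \<Sum>j'\<in>?B. ?h i' j' z) \<partial>\<mu>2)"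
    by (simp only: block_atom_def block_poly_def sum_product) (simp only: sum_distrib_right)
  also have "\<dots> = (\<Sum>i'\<in>?B. \<Sum>j'\<in>?B. \<integral>z. ?h i' j' z \<partial>\<mu>2)"
    by (simp only: Bochner_Integration.integral_sum Bochner_Integration.integrable_sum int)
  also have "\<dots> = (\<Sum>i'\<in>?B. \<Sum>j'\<in>?B. if j' = j then if i' = i then 1 else 0 else 0)"
    by (intro sum.cong refl, subst psi_orthonormal) auto
  also have "\<dots> = of_bool (i \<in> ?B \<and> j \<in> ?B)"
    by (cases "M a \<le> j \<and> j < 2 * M a") auto
  finally show ?thesis .
qed

end

section \<open>Lacunary martingales\<close>

locale lacunary_vilenkin = vilenkin +
  fixes \<alpha> :: "nat \<Rightarrow> nat" and c :: "nat \<Rightarrow> real"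
  assumes \<alpha>: "strict_mono \<alpha>" and c_nonneg: "\<And>k. c k \<ge> 0"
begin

text \<open>The \<open>n\<close>-th stage is the conditional expectation of the formal series \<open>\<Sum>k. c k * block_atom (\<alpha> k)\<close>
  on the \<open>n\<close>-th square algebra: blocks with \<open>\<alpha> k < n\<close> are kept, the others average out.\<close>
definition lacunary :: "nat \<Rightarrow> (nat \<Rightarrow> nat) \<times> (nat \<Rightarrow> nat) \<Rightarrow> complex" where
  "lacunary n z = (\<Sum>k | \<alpha> k < n. c k * block_atom (\<alpha> k) z)"

lemma finite_stage: "finite {k. \<alpha> k < n}"
  by (rule finite_subset[of _ "{..<n}"]) (use seq_suble[OF \<alpha>] le_less_trans in auto)

lemma lacunary_integrable: "integrable \<mu>2 (lacunary n)"
  unfolding lacunary_def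
  by (intro Bochner_Integration.integrable_sum integrable_mult_right block_atom_integrable)

lemma lacunary_square_measurable: "lacunary n \<in> borel_measurable (square_algebra m n)"
  unfolding lacunary_def
  by (intro borel_measurable_sum borel_measurable_times borel_measurable_const)
    (simp add: block_atom_square_measurable)

lemma lacunary_integral_square:
  assumes A: "A \<in> sets (square_algebra m n)" and "n \<le> k"
  shows "(\<integral>z. indicator A z *\<^sub>R lacunary k z \<partial>\<mu>2) = (\<integral>z. indicator A z *\<^sub>R lacunary n z \<partial>\<mu>2)"
proof -
  have "A \<in> sets \<mu>2"
    using A subalgebra_square_algebra[of m n] by (auto simp: subalgebra_def)
  then have int: "integrable \<mu>2 (\<lambda>z. indicator A z *\<^sub>R block_atom a z)" for a
    using block_atom_integrable integrable_mult_indicator by blast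
  have eq: "(\<integral>z. indicator A z *\<^sub>R lacunary K z \<partial>\<mu>2)
      = (\<Sum>j | \<alpha> j < K. c j * (\<integral>z. indicator A z *\<^sub>R block_atom (\<alpha> j) z \<partial>\<mu>2))" for K
  proof -
    have "(\<integral>z. indicator A z *\<^sub>R lacunary K z \<partial>\<mu>2)
        = (\<integral>z. (\<Sum>j | \<alpha> j < K. c j * (indicator A z *\<^sub>R block_atom (\<alpha> j) z)) \<partial>\<mu>2)"
      by (simp add: lacunary_def scaleR_sum_right)
    also have "\<dots> = (\<Sum>j | \<alpha> j < K. \<integral>z. c j * (indicator A z *\<^sub>R block_atom (\<alpha> j) z) \<partial>\<mu>2)"
      by (intro Bochner_Integration.integral_sum integrable_mult_right int)
    finally show ?thesis by (simp only: integral_mult_right_zero)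
  qed
  show ?thesis unfolding eq
    using finite_stage assms(2) block_atom_integral_square_eq_0[OF A]
    by (intro sum.mono_neutral_right) auto
qed

text \<open>On a set of the \<open>n\<close>-th algebra all blocks added after stage \<open>n\<close> integrate to zero. Real and imaginary
  parts are treated at once through a bounded linear functional \<open>g\<close>.\<close>
lemma lacunary_martingale: "martingale \<mu>2 (square_algebra m) lacunary"
  unfolding martingale_def
proof (intro conjI allI impI)
  fix n k :: nat assume "n \<le> k"
  interpret finite_measure_subalgebra \<mu>2 "square_algebra m n"
    by unfold_locales (rule subalgebra_square_algebra)
  have *: "AE z in \<mu>2. real_cond_exp \<mu>2 (square_algebra m n) (\<lambda>w. g (lacunary k w)) z = g (lacunary n z)"
    if g: "bounded_linear g" for g :: "complex \<Rightarrow> real"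
  proof (rule real_cond_exp_charact)
    show "integrable \<mu>2 (\<lambda>w. g (lacunary k w))" "integrable \<mu>2 (\<lambda>w. g (lacunary n w))"
      using g lacunary_integrable by (auto intro: integrable_bounded_linear)
    show "(\<lambda>z. g (lacunary n z)) \<in> borel_measurable (square_algebra m n)"
      by (rule measurable_compose[OF lacunary_square_measurable])
        (intro borel_measurable_continuous_onI linear_continuous_on g)
    fix A assume A: "A \<in> sets (square_algebra m n)"
    then have A': "A \<in> sets \<mu>2"
      using subalgebra_square_algebra[of m n] by (auto simp: subalgebra_def)
    have "(\<integral>z\<in>A. g (lacunary K z) \<partial>\<mu>2) = g (\<integral>z. indicator A z *\<^sub>R lacunary K z \<partial>\<mu>2)" for K
    proof -
      have "(\<integral>z\<in>A. g (lacunary K z) \<partial>\<mu>2) = (\<integral>z. g (indicator A z *\<^sub>R lacunary K z) \<partial>\<mu>2)"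
        using g by (simp add: set_lebesgue_integral_def bounded_linear.linear linear_cmul)
      also have "\<dots> = g (\<integral>z. indicator A z *\<^sub>R lacunary K z \<partial>\<mu>2)"
        using g integrable_mult_indicator[OF A' lacunary_integrable] by (rule integral_bounded_linear)
      finally show ?thesis .
    qed
    then show "(\<integral>z\<in>A. g (lacunary k z) \<partial>\<mu>2) = (\<integral>z\<in>A. g (lacunary n z) \<partial>\<mu>2)"
      using lacunary_integral_square[OF A \<open>n \<le> k\<close>] by simp
  qed
  show "AE z in \<mu>2. complex_cond_exp \<mu>2 (square_algebra m n) (lacunary k) z = lacunary n z"
    using *[OF bounded_linear_Re] *[OF bounded_linear_Im]
    by eventually_elim (simp add: complex_cond_exp_def)
qed (rule lacunary_square_measurable lacunary_integrable)+

text \<open>Only the first \<open>N\<close> blocks can reach the frequency \<open>i < N\<close>, since \<open>k \<le> \<alpha> k < M (\<alpha> k)\<close>; therefore the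
  sequence whose limit defines the coefficient is constant from stage \<open>\<alpha> N\<close> on.\<close>
lemma lacunary_fourier_coeff:
  assumes "i < N"
  shows "fourier_coeff m lacunary i j
    = (\<Sum>k<N. complex_of_real (c k) * of_bool (i \<in> {M (\<alpha> k)..<2 * M (\<alpha> k)} \<and> j \<in> {M (\<alpha> k)..<2 * M (\<alpha> k)}))"
proof -
  let ?\<delta> = "\<lambda>k. of_bool (i \<in> {M (\<alpha> k)..<2 * M (\<alpha> k)} \<and> j \<in> {M (\<alpha> k)..<2 * M (\<alpha> k)}) :: complex"
  let ?I = "\<lambda>K. \<integral>z. lacunary K z * cnj (\<psi> i (fst z)) * cnj (\<psi> j (snd z)) \<partial>\<mu>2"
  have "?I K = (\<Sum>k<N. c k * ?\<delta> k)" if K: "K \<ge> \<alpha> N" for K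
  proof -
    let ?h = "\<lambda>k z. block_atom (\<alpha> k) z * cnj (\<psi> i (fst z)) * cnj (\<psi> j (snd z))"
    have int: "integrable \<mu>2 (?h k)" for k
      by (rule bounded_integrable2[where b = "(real (M (\<alpha> k)))\<^sup>2"])
        (measurable, simp add: norm_mult norm_block_atom_le)
    have "?I K = (\<integral>z. (\<Sum>k | \<alpha> k < K. c k * ?h k z) \<partial>\<mu>2)"
      by (simp only: lacunary_def sum_distrib_right mult.assoc)
    also have "\<dots> = (\<Sum>k | \<alpha> k < K. \<integral>z. c k * ?h k z \<partial>\<mu>2)"
      by (intro Bochner_Integration.integral_sum integrable_mult_right int)
    also have "\<dots> = (\<Sum>k | \<alpha> k < K. c k * ?\<delta> k)"
      by (simp only: integral_mult_right_zero block_atom_fourier)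
    also have "\<dots> = (\<Sum>k<N. c k * ?\<delta> k)"
    proof (rule sum.mono_neutral_right[OF finite_stage])
      show "{..<N} \<subseteq> {k. \<alpha> k < K}"
        using strict_monoD[OF \<alpha>] K by (auto intro: less_le_trans)
      show "\<forall>k\<in>{k. \<alpha> k < K} - {..<N}. c k * ?\<delta> k = 0"
      proof
        fix k assume "k \<in> {k. \<alpha> k < K} - {..<N}"
        then have "i < M (\<alpha> k)"
          using assms less_M[of "\<alpha> k"] seq_suble[OF \<alpha>, of k] by simp
        then show "c k * ?\<delta> k = 0" by simp
      qed
    qed
    finally show ?thesis .
  qed
  then have "?I \<longlonglongrightarrow> (\<Sum>k<N. c k * ?\<delta> k)"
    by (intro tendsto_eventually eventually_sequentiallyI)
  then show ?thesis unfolding fourier_coeff_def by (rule limI)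
qed

text \<open>The frequency blocks are disjoint and ordered because \<open>2 * M (\<alpha> j) \<le> M (\<alpha> k)\<close> for \<open>j < k\<close>: the earlier
  blocks are summed completely, the \<open>k\<close>-th one is cut after \<open>l\<close> frequencies in each variable, and the
  later ones do not occur.\<close>
lemma lacunary_partial_sum:
  assumes l: "l < M (\<alpha> k)" and n: "n = M (\<alpha> k) + l"
  shows "partial_sum m n n lacunary z = (\<Sum>j<k. c j * block_atom (\<alpha> j) z)
    + c k * (\<psi> (M (\<alpha> k)) (fst z) * dirichlet_kernel l (fst z))
          * (\<psi> (M (\<alpha> k)) (snd z) * dirichlet_kernel l (snd z))"
proof -
  define N where "N = n + k + 1"
  define b where "b = (\<lambda>k. {M (\<alpha> k)..<2 * M (\<alpha> k)})"
  \<comment> \<open>the part of the \<open>k\<close>-th frequency block below \<open>n\<close>\<close>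
  define P where "P = (\<lambda>k x. \<Sum>i<n. of_bool (i \<in> b k) * \<psi> i x)"
  have "partial_sum m n n lacunary z = (\<Sum>i<n. \<Sum>j<n. \<Sum>k<N.
      c k * (of_bool (i \<in> b k) * \<psi> i (fst z)) * (of_bool (j \<in> b k) * \<psi> j (snd z)))"
    unfolding partial_sum_def
  proof (intro sum.cong refl)
    fix i j assume "i \<in> {..<n}"
    then have fc: "fourier_coeff m lacunary i j = (\<Sum>k<N. complex_of_real (c k) * of_bool (i \<in> b k \<and> j \<in> b k))"
      unfolding b_def by (intro lacunary_fourier_coeff) (simp add: N_def)
    show "fourier_coeff m lacunary i j * \<psi> i (fst z) * \<psi> j (snd z) = (\<Sum>k<N.
        c k * (of_bool (i \<in> b k) * \<psi> i (fst z)) * (of_bool (j \<in> b k) * \<psi> j (snd z)))"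
      unfolding fc sum_distrib_right
      by (intro sum.cong refl) (simp only: of_bool_conj mult_ac)
  qed
  also have "\<dots> = (\<Sum>i<n. \<Sum>k<N. \<Sum>j<n.
      c k * (of_bool (i \<in> b k) * \<psi> i (fst z)) * (of_bool (j \<in> b k) * \<psi> j (snd z)))"
    by (intro sum.cong refl sum.swap)
  also have "\<dots> = (\<Sum>k<N. \<Sum>i<n. \<Sum>j<n.
      c k * (of_bool (i \<in> b k) * \<psi> i (fst z)) * (of_bool (j \<in> b k) * \<psi> j (snd z)))"
    by (rule sum.swap)
  also have "\<dots> = (\<Sum>k<N. c k * P k (fst z) * P k (snd z))"
    by (simp only: P_def mult.assoc sum_product) (simp only: sum_distrib_left mult.assoc)
  also have "\<dots> = (\<Sum>j<Suc k. c j * P j (fst z) * P j (snd z))"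
  proof (rule sum.mono_neutral_right)
    show "\<forall>j\<in>{..<N} - {..<Suc k}. c j * P j (fst z) * P j (snd z) = 0"
    proof
      fix j assume "j \<in> {..<N} - {..<Suc k}"
      then have "2 * M (\<alpha> k) \<le> M (\<alpha> j)" by (intro double_M_le strict_monoD[OF \<alpha>]) simp
      then have "P j x = 0" for x
        using l n unfolding P_def b_def by (intro sum.neutral) auto
      then show "c j * P j (fst z) * P j (snd z) = 0" by simp
    qed
  qed (auto simp: N_def)
  also have "\<dots> = (\<Sum>j<k. c j * P j (fst z) * P j (snd z)) + c k * P k (fst z) * P k (snd z)"
    by simp
  also have "(\<Sum>j<k. c j * P j (fst z) * P j (snd z)) = (\<Sum>j<k. c j * block_atom (\<alpha> j) z)"
  proof (intro sum.cong refl)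
    fix j assume "j \<in> {..<k}"
    then have "2 * M (\<alpha> j) \<le> M (\<alpha> k)" by (intro double_M_le strict_monoD[OF \<alpha>]) simp
    then have "P j x = block_poly (\<alpha> j) x" for x
      using n unfolding P_def b_def block_poly_def of_bool_def
      by (intro sum.mono_neutral_cong_right) auto
    then show "c j * P j (fst z) * P j (snd z) = c j * block_atom (\<alpha> j) z"
      by (simp add: block_atom_def)
  qed
  also have "c k * P k (fst z) * P k (snd z)
    = c k * (\<psi> (M (\<alpha> k)) (fst z) * dirichlet_kernel l (fst z))
          * (\<psi> (M (\<alpha> k)) (snd z) * dirichlet_kernel l (snd z))"
  proof -
    have "P k x = \<psi> (M (\<alpha> k)) x * dirichlet_kernel l x" for x
    proof -
    have "P k x = (\<Sum>i\<in>{M (\<alpha> k)..<M (\<alpha> k) + l}. \<psi> i x)"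
      using l n unfolding P_def b_def by (intro sum.mono_neutral_cong_right) auto
    then show ?thesis using l by (simp add: block_partial_sum)
    qed
    then show ?thesis by (simp only:)
  qed
  finally show ?thesis .
qed

text \<open>The earlier blocks enter only through their trivial supremum bound, which does not depend on
  \<open>\<alpha> k\<close>.\<close>
lemma norm_lacunary_partial_sum_ge:
  assumes "l < M (\<alpha> k)" and "n = M (\<alpha> k) + l"
  shows "c k * (cmod (dirichlet_kernel l (fst z)) * cmod (dirichlet_kernel l (snd z)))
    \<le> cmod (partial_sum m n n lacunary z) + (\<Sum>j<k. c j * (real (M (\<alpha> j)))\<^sup>2)"
proof -
  let ?A = "\<Sum>j<k. c j * block_atom (\<alpha> j) z"
  let ?B = "c k * (\<psi> (M (\<alpha> k)) (fst z) * dirichlet_kernel l (fst z))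
          * (\<psi> (M (\<alpha> k)) (snd z) * dirichlet_kernel l (snd z))"
  have "cmod ?A \<le> (\<Sum>j<k. c j * (real (M (\<alpha> j)))\<^sup>2)"
    using c_nonneg
    by (intro sum_norm_le) (simp add: norm_mult mult_left_mono norm_block_atom_le)
  moreover have "cmod ?B = c k * (cmod (dirichlet_kernel l (fst z)) * cmod (dirichlet_kernel l (snd z)))"
    using c_nonneg by (simp add: norm_mult)
  moreover have "cmod ?B \<le> cmod (?A + ?B) + cmod ?A"
    using norm_triangle_ineq4[of "?A + ?B" ?A] by simp
  ultimately show ?thesis unfolding lacunary_partial_sum[OF assms] by linarith
qed

section \<open>Hardy norm of lacunary martingales\<close>

text \<open>The \<open>p\<close>-th power of the maximal function is dominated by the series \<open>H\<close> of the \<open>p\<close>-th powers of the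
  blocks, and \<open>H\<close> is integrated term by term.\<close>
lemma lacunary_in_hardy_space:
  assumes p: "0 < p" "p \<le> 1"
    and summable: "summable (\<lambda>k. (c k * (real (M (\<alpha> k)))\<^sup>2) powr p / (real (M (\<alpha> k)))\<^sup>2)"
  shows "lacunary \<in> hardy_space m p"
proof -
  let ?I = "\<lambda>k z. indicator (cylinder (\<alpha> k) \<times> cylinder (\<alpha> k)) z :: real"
  define w where "w = (\<lambda>k. (c k * (real (M (\<alpha> k)))\<^sup>2) powr p)"
  define H where "H = (\<lambda>z. \<Sum>k. ennreal (w k * ?I k z))"
  have w0: "w k \<ge> 0" for k by (simp add: w_def)
  have max: "ennreal_pow (maximal_fun lacunary z) p \<le> H z" if z: "z \<in> G \<times> G" for z
  proof (cases "H z")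
    case (real h)
    have "cmod (lacunary n z) \<le> h powr (1 / p)" for n
    proof -
      have "cmod (lacunary n z) \<le> (\<Sum>k | \<alpha> k < n. c k * (real (M (\<alpha> k)))\<^sup>2 * ?I k z)"
        unfolding lacunary_def
        by (intro sum_norm_le) (simp add: norm_mult norm_block_atom[OF z] c_nonneg mult_ac)
      then have "cmod (lacunary n z) powr p \<le> (\<Sum>k | \<alpha> k < n. c k * (real (M (\<alpha> k)))\<^sup>2 * ?I k z) powr p"
        using p by (intro powr_mono2) auto
      also have "\<dots> \<le> (\<Sum>k | \<alpha> k < n. (c k * (real (M (\<alpha> k)))\<^sup>2 * ?I k z) powr p)"
        using p c_nonneg by (intro powr_sum_le finite_stage) auto
      also have "\<dots> = (\<Sum>k | \<alpha> k < n. w k * ?I k z)"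
        by (intro sum.cong refl) (auto simp: w_def indicator_def)
      finally have "ennreal (cmod (lacunary n z) powr p) \<le> ennreal (\<Sum>k | \<alpha> k < n. w k * ?I k z)"
        by (rule ennreal_leI)
      also have "\<dots> = (\<Sum>k | \<alpha> k < n. ennreal (w k * ?I k z))"
        using w0 by (intro sum_ennreal[symmetric]) auto
      also have "\<dots> \<le> H z"
        unfolding H_def by (intro sum_le_suminf summableI finite_stage) auto
      finally have "cmod (lacunary n z) powr p \<le> h" using real by simp
      then have "(cmod (lacunary n z) powr p) powr (1 / p) \<le> h powr (1 / p)"
        using p by (intro powr_mono2) auto
      then show ?thesis using p by (simp add: powr_powr)
    qed
    then have "maximal_fun lacunary z \<le> ennreal (h powr (1 / p))"
      unfolding maximal_fun_def by (intro SUP_least ennreal_leI)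
    then have "ennreal_pow (maximal_fun lacunary z) p \<le> ennreal_pow (ennreal (h powr (1 / p))) p"
      using p by (intro ennreal_pow_mono) auto
    also have "\<dots> = H z" using p real by (simp add: ennreal_pow_ennreal powr_powr)
    finally show ?thesis .
  qed simp
  have "(\<integral>\<^sup>+z. ennreal_pow (maximal_fun lacunary z) p \<partial>\<mu>2) \<le> (\<integral>\<^sup>+z. H z \<partial>\<mu>2)"
    using max by (intro nn_integral_mono) (simp add: space_vilenkin_measure2)
  also have "\<dots> = (\<Sum>k. \<integral>\<^sup>+z. ennreal (w k * ?I k z) \<partial>\<mu>2)"
    unfolding H_def by (intro nn_integral_suminf) measurable
  also have "\<dots> = (\<Sum>k. ennreal (w k / (real (M (\<alpha> k)))\<^sup>2))"
  proof (intro suminf_cong)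
    fix k
    have "(\<integral>\<^sup>+z. ennreal (w k * ?I k z) \<partial>\<mu>2)
        = (\<integral>\<^sup>+z. ennreal (w k) * indicator (cylinder (\<alpha> k) \<times> cylinder (\<alpha> k)) z \<partial>\<mu>2)"
      using w0 by (intro nn_integral_cong) (auto simp: indicator_def)
    also have "\<dots> = ennreal (w k) * ennreal ((1 / real (M (\<alpha> k)))\<^sup>2)"
      by (subst nn_integral_cmult_indicator)
        (simp_all add: emeasure_Times measure_cylinder cylinder_square_sets)
    also have "\<dots> = ennreal (w k / (real (M (\<alpha> k)))\<^sup>2)"
      using w0 by (simp add: ennreal_mult[symmetric] power_divide)
    finally show "(\<integral>\<^sup>+z. ennreal (w k * ?I k z) \<partial>\<mu>2) = ennreal (w k / (real (M (\<alpha> k)))\<^sup>2)" .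
  qed
  also have "\<dots> < \<infinity>"
    using summable w0 by (simp add: w_def suminf_ennreal2)
  finally have "Lp_norm \<mu>2 p (maximal_fun lacunary) < \<infinity>"
    unfolding Lp_norm_def by (auto simp: ennreal_pow_def less_top)
  then show ?thesis using lacunary_martingale by (simp add: hardy_space_def)
qed

section \<open>Lower bounds for the norms of partial sums\<close>

lemma partial_sum_measurable [measurable]:
  "(\<lambda>z. partial_sum m n n' lacunary z) \<in> borel_measurable \<mu>2"
  unfolding partial_sum_def by measurable

text \<open>On the square of the zeroth shell both kernels have modulus one, since \<open>l mod M 1 = 1 = M 0\<close>. This set
  has measure at least \<open>1/4\<close>, and there the earlier blocks take away at most half of the last one.\<close>
lemma weak_norm_partial_sum_ge:
  assumes p: "0 < p" and ck: "0 < c k" and prev: "(\<Sum>j<k. c j * (real (M (\<alpha> j)))\<^sup>2) \<le> c k / 2"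
    and l: "l < M (\<alpha> k)" "l mod m 0 = 1" and n: "n = M (\<alpha> k) + l"
  shows "ennreal ((c k / 4) powr p * (1 / 4))
    \<le> ennreal_pow (weak_Lp_norm \<mu>2 p (\<lambda>z. ennreal (cmod (partial_sum m n n lacunary z)))) p"
proof (rule weak_Lp_norm_powr_ge[where S = "shell 0 \<times> shell 0"])
  show "shell 0 \<times> shell 0 \<in> sets \<mu>2"
    unfolding vilenkin_measure2_def by (intro pair_measureI shell_sets)
  have "(1 / 2)\<^sup>2 \<le> (measure \<mu> (shell 0))\<^sup>2"
    using measure_shell[of 0] by (intro power_mono) (auto simp: shell_def)
  then show "ennreal (1 / 4) \<le> emeasure \<mu>2 (shell 0 \<times> shell 0)"
    by (simp add: emeasure_Times power2_eq_square ennreal_leI)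
  fix z assume z: "z \<in> shell 0 \<times> shell 0"
  have D: "cmod (dirichlet_kernel l x) = 1" if "x \<in> shell 0" for x
    using norm_dirichlet_kernel[of x 0 l] that l(2) by (simp add: mem_shell)
  have "c k \<le> cmod (partial_sum m n n lacunary z) + (\<Sum>j<k. c j * (real (M (\<alpha> j)))\<^sup>2)"
    using norm_lacunary_partial_sum_ge[OF l(1) n, of z] D z by (auto simp: mem_Times_iff)
  then show "c k / 4 < cmod (partial_sum m n n lacunary z)" using prev ck by linarith
qed (use p ck in \<open>auto intro: borel_measurable_norm partial_sum_measurable\<close>)

lemma L1_norm_partial_sum_ge:
  assumes l: "l < M (\<alpha> k)" and n: "n = M (\<alpha> k) + l"
  shows "ennreal (c k * (lebesgue_constant l)\<^sup>2 - (\<Sum>j<k. c j * (real (M (\<alpha> j)))\<^sup>2))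
    \<le> Lp_norm \<mu>2 1 (\<lambda>z. ennreal (cmod (partial_sum m n n lacunary z)))"
proof -
  let ?C = "\<Sum>j<k. c j * (real (M (\<alpha> j)))\<^sup>2"
  let ?D = "\<lambda>z. cmod (dirichlet_kernel l (fst z)) * cmod (dirichlet_kernel l (snd z))"
  let ?S = "\<lambda>z. cmod (partial_sum m n n lacunary z)"
  have C0: "?C \<ge> 0" using c_nonneg by (intro sum_nonneg) simp
  have meas: "(\<lambda>z. ennreal (?D z)) \<in> borel_measurable \<mu>2"
    using measurable_compose[OF fst_measurable dirichlet_kernel_measurable]
      measurable_compose[OF snd_measurable dirichlet_kernel_measurable] by measurable
  have "ennreal (c k * (lebesgue_constant l)\<^sup>2) = ennreal (c k) * ennreal ((lebesgue_constant l)\<^sup>2)"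
    using c_nonneg by (intro ennreal_mult) auto
  also have "\<dots> = (\<integral>\<^sup>+z. ennreal (c k) * ennreal (?D z) \<partial>\<mu>2)"
    by (simp only: nn_integral_cmult[OF meas] nn_integral_dirichlet_square)
  also have "\<dots> \<le> (\<integral>\<^sup>+z. ennreal (?S z) + ennreal ?C \<partial>\<mu>2)"
    using norm_lacunary_partial_sum_ge[OF l n] c_nonneg C0
    by (intro nn_integral_mono) (simp add: ennreal_mult[symmetric] ennreal_plus[symmetric] ennreal_leI del: ennreal_plus)
  also have "\<dots> = (\<integral>\<^sup>+z. ennreal (?S z) \<partial>\<mu>2) + ennreal ?C"
    by (subst nn_integral_add) (auto simp: mu2.emeasure_space_1)
  finally have "ennreal (c k * (lebesgue_constant l)\<^sup>2) - ennreal ?C \<le> (\<integral>\<^sup>+z. ennreal (?S z) \<partial>\<mu>2)"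
    by (simp add: ennreal_minus_le_iff add.commute)
  then show ?thesis using C0 by (simp add: Lp_norm_def ennreal_minus)
qed

end

section \<open>Divergence\<close>

context vilenkin begin

text \<open>Normalized so that the block at \<open>a\<close> with this coefficient has \<open>p\<close>-th power norm \<open>2 ^ -k\<close>; for \<open>p = 1\<close>
  the factor depending on \<open>a\<close> disappears.\<close>
definition atom_coeff :: "real \<Rightarrow> nat \<Rightarrow> nat \<Rightarrow> real" where
  "atom_coeff p k a = 2 powr (- real k / p) * real (M a) powr (2 / p - 2)"

lemma atom_coeff_pos: "atom_coeff p k a > 0"
  using M_pos[of a] by (simp add: atom_coeff_def)

lemma atom_coeff_powr:
  assumes "0 < p"
  shows "atom_coeff p k a powr p = (1 / 2) ^ k * real (M a) powr (2 - 2 * p)"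
proof -
  have "atom_coeff p k a powr p = 2 powr (- real k) * real (M a) powr (2 - 2 * p)"
    using assms by (simp add: atom_coeff_def powr_mult powr_powr left_diff_distrib)
  then show ?thesis by (simp add: powr_minus powr_realpow power_one_over inverse_eq_divide)
qed

lemma atom_coeff_normalized:
  assumes "0 < p"
  shows "(atom_coeff p k a * (real (M a))\<^sup>2) powr p / (real (M a))\<^sup>2 = (1 / 2) ^ k"
proof -
  have M0: "real (M a) > 0" by simp
  have "(atom_coeff p k a * (real (M a))\<^sup>2) powr p = atom_coeff p k a powr p * ((real (M a))\<^sup>2) powr p"
    using atom_coeff_pos[of p k a] by (simp add: powr_mult)
  also have "((real (M a))\<^sup>2) powr p = real (M a) powr (2 * p)"
    using M0 by (simp add: powr_powr flip: powr_numeral)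
  also have "atom_coeff p k a powr p * real (M a) powr (2 * p) = (1 / 2) ^ k * (real (M a))\<^sup>2"
    using M0 by (simp add: atom_coeff_powr[OF assms] powr_add[symmetric] flip: powr_numeral)
  finally show ?thesis using M0 by simp
qed

lemma lacunary_vilenkin_atom_coeff:
  assumes "strict_mono \<alpha>"
  shows "lacunary_vilenkin m \<alpha> (\<lambda>k. atom_coeff p k (\<alpha> k))"
  using assms atom_coeff_pos by unfold_locales (auto simp: less_imp_le)

lemma filterlim_M: "filterlim (\<lambda>a. real (M a)) at_top sequentially"
  by (rule filterlim_at_top_mono[OF filterlim_real_sequentially])
    (use less_M in \<open>auto intro!: always_eventually less_imp_le\<close>)

lemma eventually_Phi_M_ge:
  assumes "filterlim \<Phi> at_top sequentially"
  shows "eventually (\<lambda>a. (b :: real) \<le> \<Phi> (M a)) sequentially"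
proof -
  have "filterlim M at_top sequentially"
    using filterlim_M by (simp add: filterlim_sequentially_iff_filterlim_real)
  then have "filterlim (\<lambda>a. \<Phi> (M a)) at_top sequentially"
    by (rule filterlim_compose[OF assms])
  then show ?thesis by (simp add: filterlim_at_top)
qed

text \<open>For \<open>p < 1\<close> the coefficient tends to infinity with \<open>a\<close>, so it dominates any bound \<open>C\<close> of the earlier
  blocks. An index \<open>n = M (\<alpha> k) + l\<close> with \<open>l mod m 0 = 1\<close> contributes at least \<open>2 ^ k / (128 * M (\<alpha> k))\<close>,
  and there are \<open>M (\<alpha> k) / m 0\<close> of them.\<close>
lemma weak_divergence:
  fixes p :: real and \<Phi> :: "nat \<Rightarrow> real"
  assumes p: "0 < p" "p < 1"
    and \<Phi>: "\<And>n. \<Phi> n \<ge> 1" "mono \<Phi>" "filterlim \<Phi> at_top sequentially"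
  shows "\<exists>f \<in> hardy_space m p.
    (\<Sum>k. let n = Suc k in
       ennreal_pow (weak_Lp_norm \<mu>2 p (\<lambda>z. ennreal (cmod (partial_sum m n n f z)))) p
       * ennreal (\<Phi> n) / ennreal (real n powr (3 - 2 * p))) = \<infinity>"
proof -
  define Q where "Q = (\<lambda>k C a. 1 \<le> a \<and> 4 ^ k \<le> \<Phi> (M a) \<and> C \<le> atom_coeff p k a / 2)"
  have "eventually (Q k C) sequentially" for k C
  proof -
    have "filterlim (\<lambda>a. atom_coeff p k a) at_top sequentially"
      unfolding atom_coeff_def
    proof (rule filterlim_tendsto_pos_mult_at_top[OF tendsto_const])
      have "2 / p - 2 > 0" using p by (simp add: field_simps)
      then have "filterlim (\<lambda>x::real. x powr (2 / p - 2)) at_top at_top" by real_asymp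
      then show "filterlim (\<lambda>a. real (M a) powr (2 / p - 2)) at_top sequentially"
        using filterlim_M by (rule filterlim_compose)
    qed simp
    then have "eventually (\<lambda>a. 2 * C \<le> atom_coeff p k a) sequentially" by (simp add: filterlim_at_top)
    with eventually_ge_at_top[of 1] eventually_Phi_M_ge[OF \<Phi>(3), of "4 ^ k"]
    show ?thesis unfolding Q_def by eventually_elim auto
  qed
  then obtain \<alpha> where \<alpha>: "strict_mono \<alpha>"
    and Q: "\<And>k. Q k (\<Sum>j<k. atom_coeff p j (\<alpha> j) * (real (M (\<alpha> j)))\<^sup>2) (\<alpha> k)"
    using greedy_strict_mono_sequence[of Q "\<lambda>j a. atom_coeff p j a * (real (M a))\<^sup>2"] by blast
  interpret lacunary_vilenkin m \<alpha> "\<lambda>k. atom_coeff p k (\<alpha> k)"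
    using \<alpha> by (rule lacunary_vilenkin_atom_coeff)
  define F where "F = (\<lambda>n. ennreal_pow (weak_Lp_norm \<mu>2 p
      (\<lambda>z. ennreal (cmod (partial_sum m n n lacunary z)))) p
      * ennreal (\<Phi> n) / ennreal (real n powr (3 - 2 * p)))"
  define L where "L = (\<lambda>k. (\<lambda>u. u * m 0 + 1) ` {..<M (\<alpha> k) div m 0})"
  have "(\<Sum>k. F (Suc k)) = \<infinity>"
  proof (rule suminf_eq_top_of_blocks[where L = L and a = "\<lambda>k. M (\<alpha> k)" and d = "1 / (128 * real (m 0))"])
    fix k
    let ?M = "M (\<alpha> k)"
    have Qk: "1 \<le> \<alpha> k" "4 ^ k \<le> \<Phi> ?M"
      "(\<Sum>j<k. atom_coeff p j (\<alpha> j) * (real (M (\<alpha> j)))\<^sup>2) \<le> atom_coeff p k (\<alpha> k) / 2"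
      using Q[of k] by (auto simp: Q_def)
    have dvd: "m 0 dvd ?M" using M_dvd[of 1 "\<alpha> k"] Qk(1) by simp
    have F_ge: "ennreal (2 ^ k / (128 * real ?M)) \<le> F (?M + l)" if lL: "l \<in> L k" for l
    proof -
      obtain u where u: "u < ?M div m 0" "l = u * m 0 + 1" using lL by (auto simp: L_def)
      have "(u + 1) * m 0 \<le> ?M div m 0 * m 0" using u(1) by (intro mult_right_mono) auto
      then have "(u + 1) * m 0 \<le> ?M" using dvd by simp
      then have "l < ?M" using u(2) m_ge[of 0] by auto
      moreover have "l mod m 0 = 1" unfolding u(2) mod_mult_self3 using m_ge[of 0] by simp
      ultimately have l: "l < ?M" "l mod m 0 = 1" by auto
      let ?n = "?M + l"
      define x where "x = (atom_coeff p k (\<alpha> k) / 4) powr p * (1 / 4)"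
      have x0: "0 \<le> x" by (simp add: x_def)
      have n_pos: "real ?n > 0" using M_pos[of "\<alpha> k"] by linarith
      have "(1 / 4) powr 1 \<le> (1 / 4 :: real) powr p" using p by (intro powr_mono') auto
      then have "(1 / 2) ^ k * real ?M powr (2 - 2 * p) * (1 / 4) * (1 / 4) \<le> x"
        using p atom_coeff_pos[of p k "\<alpha> k"] powr_mult[of "atom_coeff p k (\<alpha> k)" "1 / 4" p]
        by (simp add: x_def atom_coeff_powr mult_left_mono)
      moreover have "4 ^ k \<le> \<Phi> ?n" using Qk(2) monoD[OF \<Phi>(2), of ?M ?n] by simp
      ultimately have num: "(1 / 2) ^ k * real ?M powr (2 - 2 * p) * (1 / 4) * (1 / 4) * 4 ^ k \<le> x * \<Phi> ?n"
        by (intro mult_mono) (auto simp: x_def)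
      have "real ?n powr (3 - 2 * p) \<le> (2 * real ?M) powr (3 - 2 * p)"
        using l p by (intro powr_mono2) auto
      also have "\<dots> = 2 powr (3 - 2 * p) * real ?M powr (3 - 2 * p)" by (simp add: powr_mult)
      also have "\<dots> \<le> 2 powr 3 * real ?M powr (3 - 2 * p)"
        using p by (intro mult_right_mono powr_mono) auto
      also have "real ?M powr (3 - 2 * p) = real ?M * real ?M powr (2 - 2 * p)"
        using powr_add[of "real ?M" 1 "2 - 2 * p"] by simp
      finally have den: "real ?n powr (3 - 2 * p) \<le> 8 * (real ?M * real ?M powr (2 - 2 * p))" by simp
      have "2 ^ k / (128 * real ?M) =
          (1 / 2) ^ k * real ?M powr (2 - 2 * p) * (1 / 4) * (1 / 4) * 4 ^ k
            / (8 * (real ?M * real ?M powr (2 - 2 * p)))"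
      proof -
        have "(4::real) ^ k = 2 ^ k * 2 ^ k" by (simp flip: power_mult_distrib)
        then show ?thesis by (simp add: field_simps power_one_over)
      qed
      also have "\<dots> \<le> x * \<Phi> ?n / real ?n powr (3 - 2 * p)"
      proof (rule frac_le[OF _ num _ den])
        show "0 < real ?n powr (3 - 2 * p)" using n_pos by simp
        show "0 \<le> x * \<Phi> ?n" using \<Phi>(1)[of ?n] by (simp add: x_def)
      qed
      finally have "ennreal (2 ^ k / (128 * real ?M)) \<le> ennreal (x * \<Phi> ?n / real ?n powr (3 - 2 * p))"
        by (rule ennreal_leI)
      also have "\<dots> = ennreal x * ennreal (\<Phi> ?n) / ennreal (real ?n powr (3 - 2 * p))"
        using \<Phi>(1)[of ?n] n_pos x0
        by (simp add: divide_ennreal ennreal_mult[symmetric])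
      also have "\<dots> \<le> F ?n"
        unfolding F_def x_def using p atom_coeff_pos Qk(3) l
        by (intro divide_right_mono_ennreal mult_right_mono weak_norm_partial_sum_ge) auto
      finally show ?thesis .
    qed
    have "card (L k) = ?M div m 0"
      unfolding L_def by (subst card_image) (auto simp: inj_on_def)
    then have "(\<Sum>l\<in>L k. ennreal (2 ^ k / (128 * real ?M))) = ennreal (real (?M div m 0) * (2 ^ k / (128 * real ?M)))"
      by (subst sum_ennreal) simp_all
    also have "real (?M div m 0) * (2 ^ k / (128 * real ?M)) = 2 ^ k * (1 / (128 * real (m 0)))"
      using dvd by (simp add: real_of_nat_div field_simps)
    finally have "ennreal (2 ^ k * (1 / (128 * real (m 0)))) = (\<Sum>l\<in>L k. ennreal (2 ^ k / (128 * real ?M)))" ..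
    also have "\<dots> \<le> (\<Sum>l\<in>L k. F (?M + l))" using F_ge by (rule sum_mono)
    finally show "ennreal (2 ^ k * (1 / (128 * real (m 0)))) \<le> (\<Sum>l\<in>L k. F (?M + l))" .
  qed (auto simp: L_def Suc_le_eq)
  moreover have "lacunary \<in> hardy_space m p"
    using p by (intro lacunary_in_hardy_space) (auto simp: atom_coeff_normalized)
  ultimately show ?thesis unfolding Let_def F_def by blast
qed

text \<open>Here all \<open>l < M (\<alpha> k)\<close> are used, with the weights \<open>1 / (n * ln (n + 1) ^ 2)\<close> bounded below by their
  size at the end of the block, where the logarithm is at most \<open>2 * \<alpha> k * ln B\<close>. The growth \<open>\<Lambda>\<close> of the
  mean of the squared Lebesgue constants both absorbs the bound \<open>C\<close> of the earlier blocks and cancels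
  the squared logarithm.\<close>
lemma L1_divergence:
  fixes \<Phi> :: "nat \<Rightarrow> real"
  assumes bdd: "bdd_above (range m)"
    and \<Phi>: "\<And>n. \<Phi> n \<ge> 1" "mono \<Phi>" "filterlim \<Phi> at_top sequentially"
  shows "\<exists>f \<in> hardy_space m 1.
    (\<Sum>k. let n = Suc k in
       Lp_norm \<mu>2 1 (\<lambda>z. ennreal (cmod (partial_sum m n n f z)))
       * ennreal (\<Phi> n) / ennreal (real n * (ln (real n + 1))\<^sup>2)) = \<infinity>"
proof -
  obtain B where B: "\<And>k. m k \<le> B" using bdd by (auto simp: bdd_above_def)
  have B2: "B \<ge> 2" using B[of 0] m_ge[of 0] by linarith
  define b where "b = ln (real B)"
  have b: "b > 0" using B2 by (simp add: b_def)
  have atom_coeff_1: "atom_coeff 1 k a = (1 / 2) ^ k" for k a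
    by (simp add: atom_coeff_def powr_minus powr_realpow power_one_over inverse_eq_divide)
  define \<Lambda> where "\<Lambda> = (\<lambda>a. (real a / (4 * real B))\<^sup>2)"
  define Q where "Q = (\<lambda>k C a. 1 \<le> a \<and> 4 ^ k \<le> \<Phi> (M a) \<and> C \<le> (1 / 2) ^ k * \<Lambda> a / 2)"
  have "eventually (Q k C) sequentially" for k C
  proof -
    have "filterlim (\<lambda>a. (1 / 2) ^ k * \<Lambda> a / 2) at_top sequentially"
      unfolding \<Lambda>_def using B2 by real_asymp
    then have "eventually (\<lambda>a. C \<le> (1 / 2) ^ k * \<Lambda> a / 2) sequentially" by (simp add: filterlim_at_top)
    with eventually_ge_at_top[of 1] eventually_Phi_M_ge[OF \<Phi>(3), of "4 ^ k"]
    show ?thesis unfolding Q_def by eventually_elim auto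
  qed
  then obtain \<alpha> where \<alpha>: "strict_mono \<alpha>"
    and Q: "\<And>k. Q k (\<Sum>j<k. atom_coeff 1 j (\<alpha> j) * (real (M (\<alpha> j)))\<^sup>2) (\<alpha> k)"
    using greedy_strict_mono_sequence[of Q "\<lambda>j a. atom_coeff 1 j a * (real (M a))\<^sup>2"] by blast
  interpret lacunary_vilenkin m \<alpha> "\<lambda>k. atom_coeff 1 k (\<alpha> k)"
    using \<alpha> by (rule lacunary_vilenkin_atom_coeff)
  define F where "F = (\<lambda>n. Lp_norm \<mu>2 1 (\<lambda>z. ennreal (cmod (partial_sum m n n lacunary z)))
       * ennreal (\<Phi> n) / ennreal (real n * (ln (real n + 1))\<^sup>2))"
  have "(\<Sum>k. F (Suc k)) = \<infinity>"
  proof (rule suminf_eq_top_of_blocks[where L = "\<lambda>k. {..<M (\<alpha> k)}" and a = "\<lambda>k. M (\<alpha> k)"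
        and d = "1 / (256 * (real B)\<^sup>2 * b\<^sup>2)"])
    fix k
    let ?a = "\<alpha> k" and ?M = "M (\<alpha> k)"
    define C where "C = (\<Sum>j<k. atom_coeff 1 j (\<alpha> j) * (real (M (\<alpha> j)))\<^sup>2)"
    have Qk: "1 \<le> ?a" "4 ^ k \<le> \<Phi> ?M" "C \<le> (1 / 2) ^ k * \<Lambda> ?a / 2"
      using Q[of k] by (auto simp: Q_def C_def)
    define w where "w = 4 ^ k / (2 * real ?M * (2 * real ?a * b)\<^sup>2)"
    have w0: "w \<ge> 0" by (simp add: w_def)
    have "?M \<le> B ^ ?a"
    proof -
      have "M a \<le> B ^ a" for a using B by (induction a) (auto intro: mult_mono)
      then show ?thesis .
    qed
    have log_le: "ln (real (2 * ?M)) \<le> 2 * real ?a * b"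
    proof -
      have "2 * ?M \<le> B * B ^ ?a" using B2 \<open>?M \<le> B ^ ?a\<close> by (rule mult_mono) auto
      also have "\<dots> = B ^ Suc ?a" by simp
      also have "\<dots> \<le> B ^ (2 * ?a)" using B2 Qk(1) by (intro power_increasing) auto
      finally have "real (2 * ?M) \<le> real B ^ (2 * ?a)" by (metis of_nat_le_iff of_nat_power)
      then have "ln (real (2 * ?M)) \<le> ln (real B ^ (2 * ?a))" by (intro ln_mono) auto
      also have "\<dots> = 2 * real ?a * b" using B2 by (simp add: ln_realpow b_def)
      finally show ?thesis .
    qed
    have F_ge: "ennreal (((1 / 2) ^ k * (lebesgue_constant l)\<^sup>2 - C) * w) \<le> F (?M + l)"
      if l: "l \<in> {..<?M}" for l
    proof -
      let ?n = "?M + l"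
      define x where "x = (1 / 2) ^ k * (lebesgue_constant l)\<^sup>2 - C"
      define y where "y = \<Phi> ?n / (real ?n * (ln (real ?n + 1))\<^sup>2)"
      have n1: "real ?n \<ge> 1" using M_pos[of ?a] by linarith
      have n_ln: "0 < real ?n * (ln (real ?n + 1))\<^sup>2" using n1 by simp
      have y0: "0 \<le> y" using \<Phi>(1)[of ?n] by (simp add: y_def)
      have "w \<le> y" unfolding w_def y_def
      proof (rule frac_le)
        show "4 ^ k \<le> \<Phi> ?n" using Qk(2) monoD[OF \<Phi>(2), of ?M ?n] by simp
        then show "0 \<le> \<Phi> ?n" using \<Phi>(1)[of ?n] by simp
        show "0 < real ?n * (ln (real ?n + 1))\<^sup>2" by (rule n_ln)
        have "ln (real ?n + 1) \<le> ln (real (2 * ?M))" using l n1 by (intro ln_mono) auto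
        from this log_le have "ln (real ?n + 1) \<le> 2 * real ?a * b" by (rule order_trans)
        then show "real ?n * (ln (real ?n + 1))\<^sup>2 \<le> 2 * real ?M * (2 * real ?a * b)\<^sup>2"
          using l n1 by (intro mult_mono power_mono) auto
      qed
      then have "ennreal (x * w) \<le> ennreal x * ennreal y"
      \<comment> \<open>\<open>ennreal\<close> cuts off negative values, which is harmless for a lower bound\<close>
      proof (cases "x \<ge> 0")
        case True
        then have "ennreal (x * w) \<le> ennreal (x * y)" using \<open>w \<le> y\<close> by (intro ennreal_leI mult_left_mono)
        then show ?thesis using True y0 by (simp add: ennreal_mult)
      next
        case False
        then have "x * w \<le> 0" using w0 by (intro mult_nonpos_nonneg) auto
        then show ?thesis by (simp add: ennreal_neg)
      qed
      also have "ennreal x * ennreal y = ennreal x * ennreal (\<Phi> ?n) / ennreal (real ?n * (ln (real ?n + 1))\<^sup>2)"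
        using n_ln \<Phi>(1)[of ?n] unfolding y_def
        by (subst divide_ennreal[symmetric]) (auto simp: ennreal_times_divide)
      also have "\<dots> \<le> F ?n"
        unfolding F_def x_def C_def using l L1_norm_partial_sum_ge[of l k ?n]
        by (intro divide_right_mono_ennreal mult_right_mono) (auto simp: atom_coeff_1)
      finally show ?thesis by (simp add: x_def)
    qed
    have "2 ^ k * (1 / (256 * (real B)\<^sup>2 * b\<^sup>2)) = real ?M * ((1 / 2) ^ k * \<Lambda> ?a / 2) * w"
    proof -
      have "(4::real) ^ k = 2 ^ k * 2 ^ k" by (simp flip: power_mult_distrib)
      moreover have "real ?a > 0" using Qk(1) by simp
      ultimately show ?thesis
        using b B2 by (simp add: w_def \<Lambda>_def field_simps power_one_over power2_eq_square)
    qed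
    also have "\<dots> \<le> (\<Sum>l<?M. (1 / 2) ^ k * (lebesgue_constant l)\<^sup>2 - C) * w"
    proof (rule mult_right_mono[OF _ w0])
      have "real ?M * ((1 / 2) ^ k * \<Lambda> ?a / 2) \<le> (1 / 2) ^ k * (real ?M * \<Lambda> ?a) - real ?M * C"
      proof -
        have "real ?M * C \<le> real ?M * ((1 / 2) ^ k * \<Lambda> ?a / 2)"
          using Qk(3) by (intro mult_left_mono) auto
        moreover have "real ?M * ((1 / 2) ^ k * \<Lambda> ?a / 2)
            = (1 / 2) ^ k * (real ?M * \<Lambda> ?a) - real ?M * ((1 / 2) ^ k * \<Lambda> ?a / 2)"
          by simp
        ultimately show ?thesis by linarith
      qed
      also have "\<dots> \<le> (1 / 2) ^ k * (\<Sum>l<?M. (lebesgue_constant l)\<^sup>2) - real ?M * C"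
        using sum_lebesgue_constant_square_ge[OF B, of ?a] by (simp add: \<Lambda>_def)
      also have "\<dots> = (\<Sum>l<?M. (1 / 2) ^ k * (lebesgue_constant l)\<^sup>2 - C)"
        by (simp add: sum_subtractf sum_distrib_left)
      finally show "real ?M * ((1 / 2) ^ k * \<Lambda> ?a / 2) \<le> (\<Sum>l<?M. (1 / 2) ^ k * (lebesgue_constant l)\<^sup>2 - C)" .
    qed
    also have "\<dots> = (\<Sum>l<?M. ((1 / 2) ^ k * (lebesgue_constant l)\<^sup>2 - C) * w)"
      by (rule sum_distrib_right)
    finally have "ennreal (2 ^ k * (1 / (256 * (real B)\<^sup>2 * b\<^sup>2)))
        \<le> ennreal (\<Sum>l<?M. ((1 / 2) ^ k * (lebesgue_constant l)\<^sup>2 - C) * w)"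
      by (rule ennreal_leI)
    also have "\<dots> \<le> (\<Sum>l<?M. ennreal (((1 / 2) ^ k * (lebesgue_constant l)\<^sup>2 - C) * w))"
      by (rule ennreal_sum_le)
    also have "\<dots> \<le> (\<Sum>l<?M. F (?M + l))" using F_ge by (rule sum_mono)
    finally show "ennreal (2 ^ k * (1 / (256 * (real B)\<^sup>2 * b\<^sup>2))) \<le> (\<Sum>l<?M. F (?M + l))" .
  qed (use b B2 in \<open>auto simp: Suc_le_eq\<close>)
  moreover have "lacunary \<in> hardy_space m 1"
  proof (rule lacunary_in_hardy_space)
    show "summable (\<lambda>k. (atom_coeff 1 k (\<alpha> k) * (real (M (\<alpha> k)))\<^sup>2) powr 1 / (real (M (\<alpha> k)))\<^sup>2)"
      unfolding atom_coeff_normalized[OF zero_less_one] by simp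
  qed simp_all
  ultimately show ?thesis unfolding Let_def F_def by blast
qed

end

theorem theorem2:
  fixes m :: "nat \<Rightarrow> nat"
  assumes m_ge: "\<And>k. m k \<ge> 2" and m_bdd: "bdd_above (range m)"
  shows
    "(\<forall>(p::real) (\<Phi> :: nat \<Rightarrow> real).
        0 < p \<and> p < 1 \<and> (\<forall>n. \<Phi> n \<ge> 1) \<and> mono \<Phi> \<and> filterlim \<Phi> at_top sequentially \<longrightarrow>
        (\<exists>f \<in> hardy_space m p.
          (\<Sum>k. let n = Suc k in
             ennreal_pow (weak_Lp_norm (vilenkin_measure2 m) p
                (\<lambda>z. ennreal (cmod (partial_sum m n n f z)))) p
             * ennreal (\<Phi> n) / ennreal (real n powr (3 - 2 * p))) = \<infinity>))
     \<and>
     (\<forall>\<Phi> :: nat \<Rightarrow> real.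
        (\<forall>n. \<Phi> n \<ge> 1) \<and> mono \<Phi> \<and> filterlim \<Phi> at_top sequentially \<longrightarrow>
        (\<exists>f \<in> hardy_space m 1.
          (\<Sum>k. let n = Suc k in
             Lp_norm (vilenkin_measure2 m) 1
                (\<lambda>z. ennreal (cmod (partial_sum m n n f z)))
             * ennreal (\<Phi> n) / ennreal (real n * (ln (real n + 1))\<^sup>2)) = \<infinity>))"
proof -
  interpret vilenkin m using m_ge by unfold_locales
  show ?thesis using weak_divergence L1_divergence[OF m_bdd] by blast
qed

end
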